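(* There exist universal positive constants $c', c_1, c_2, c_3$ such that the following holds. Let $n\in\mathbb{N}$, let $v_1,\dots,v_n$ be computation powers (non-negative, continuous almost everywhere functions $\mathbb{R}_+\to\mathbb{R}_+$) with associated functions $V_i(t)=\int_0^t v_i(\tau)\,d\tau$, and let $L,\Delta,\varepsilon>0$ and $\sigma^2\ge 0$ satisfy $\varepsilon<c' L\Delta$. Then, in a suitable dimension $d\in\mathbb{N}$, for any zero-respecting algorithm $A\in\mathcal{A}_{\mathrm{zr}}$ one can sample functions $f_1,\dots,f_n:\mathbb{R}^d\to\mathbb{R}$ from some distribution of functions such that: (a) deterministically, $f=\frac1n\sum_{i=1}^n f_i$ is differentiable and $L$-smooth, i.e. $\|\nabla f(x)-\nabla f(y)\|\le L\|x-y\|$ for all $x,y\in\mathbb{R}^d$, and there is $f^*\in\mathbb{R}$ with $f(x)\ge f^*$ for all $x\in\mathbb{R}^d$ and $f(0)-f^*\le\Delta$; and (b) there exist stochastic gradient mappings $g_1,\dots,g_n$ for the oracles $O_1,\dots,O_n$ satisfying $\mathbb{E}_{\xi}[g_i(s_x;\xi,t)]=\nabla f_i(s_x)$ and $\mathbb{E}_{\xi}[\|g_i(s_x;\xi,t)-\nabla f_i(s_x)\|^2]\le\sigma^2$ for all $s_x\in\mathbb{R}^d$, $i\in[n]$, $t\ge0$, such that the sequences $x^k,t^k$ generated by the Time Multiple Oracles Protocol with $A$ and $O_1,\dots,O_n$ satisfy $$\mathbb{E}\Big[\inf_{k\in S_t}\|\nabla f(x^k)\|^2\Big]>\varepsilon,\qquad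 S_t:=\{k\in\mathbb{N}_0 : t^k\le t\},\qquad t=\tfrac12\,\underline{t}_{\lfloor c_1 L\Delta/\varepsilon\rfloor},$$ where the expectation is taken over all randomness, $\underline{t}_0=0$ and, for all $k\ge1$, $$\underline{t}_k:=\min\left\{t\ge0 : \left(\frac1n\sum_{i=1}^n\Big\lfloor c_3\big(V_i(t)-V_i(\underline{t}_{k-1})\big)\Big\rfloor^{-1}\right)^{-1}\ge \max\Big\{c_2\,\frac{\sigma^2}{n\varepsilon},1\Big\}\right\}.$$
   Context: Notation: $\mathbb{R}_+=[0,\infty)$, $\mathbb{N}=\{1,2,\dots\}$, $\mathbb{N}_0=\{0,1,2,\dots\}$, $[n]=\{1,\dots,n\}$, $\operatorname{supp}(x)=\{i\in[d]:x_i\ne0\}$, $\|\cdot\|$ is the Euclidean norm. Conventions: $\min\emptyset=\infty$, $0^{-1}=\infty$, $\infty^{-1}=0$, and $\underline{t}_k=\infty$ if $\underline{t}_{k-1}=\infty$. "Universal constants" are numbers independent of all other parameters. Computation powers: for each worker $i\in[n]$, $v_i:\mathbb{R}_+\to\mathbb{R}_+$ is non-negative and continuous almost everywhere, and $V_i(t)=\int_0^t v_i(\tau)d\tau$ (Riemann integral), which is continuous and non-decreasing on $\mathbb{R}_+$. Oracles: each oracle $O_i$ has a state $(s_t,s_x,s_q)\in\mathbb{R}_+\times\mathbb{R}^d\times\{0,1\}$. It takes a time $t\in\mathbb{R}_+$, a point $x\in\mathbb{R}^d$, an input state, and a control $c\in\{0,1\}$, and returns an output state and an output vector in $\mathbb{R}^d$: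 $$O_i(t,x,(s_t,s_x,s_q),c)=\begin{cases}((t,x,1),\,0), & c=0,\ s_q=0,\\ ((s_t,s_x,1),\,0), & c=0,\ s_q=1,\ V_i(t)-V_i(s_t)<1,\\ ((0,0,0),\,g_i(s_x;\xi,t)), & c=0,\ s_q=1,\ V_i(t)-V_i(s_t)\ge1,\\ ((0,0,0),\,0), & c=1,\end{cases}$$ where $\xi\sim\mathcal{D}_{s_x,t,i}$, $\mathcal{D}_{s_x,t,i}$ is some distribution on a set $\mathbb{S}_\xi$ that can depend on $s_x,t,i$, and $g_i:\mathbb{R}^d\times\mathbb{S}_\xi\times\mathbb{R}_+\to\mathbb{R}^d$ is a mapping (the stochastic gradient mapping). $\mathbb{E}_\xi$ denotes the expectation over $\xi\sim\mathcal{D}_{s_x,t,i}$. Time Multiple Oracles Protocol, for an algorithm $A=\{A^k\}_{k\ge0}$ and oracles $O_1,\dots,O_n$: set $s_i^0=(0,0,0)$ for all $i$ and $t^0=0$. For $k=0,1,2,\dots$: (1) $(t^{k+1},i^{k+1},c^{k+1},x^k)=A^k(g^1,\dots,g^k)$; (2) $(s^{k+1}_{i^{k+1}},g^{k+1})=O_{i^{k+1}}(t^{k+1},x^k,s^k_{i^{k+1}},c^{k+1})$, and $s_j^{k+1}=s_j^k$ for $j\ne i^{k+1}$. (Here $g^k$ with an upper index denotes the vectors returned by the oracles.) Class $\mathcal{A}_{\mathrm{zr}}$ of zero-respecting algorithms: $A=\{A^k\}_{k=0}^\infty$ such that (1) $A^0\in\mathbb{R}_+\times[n]\times\{0,1\}\times\mathbb{R}^d$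 and $A^k:(\mathbb{R}^d)^k\to\mathbb{R}_+\times[n]\times\{0,1\}\times\mathbb{R}^d$ for $k\ge1$; (2) $\operatorname{supp}(x^k)\subseteq\bigcup_{j=1}^k\operatorname{supp}(g^j)$ for all $k\in\mathbb{N}_0$ (so $x^0=0$); (3) for all $k\ge1$ and all $g^1,\dots,g^k\in\mathbb{R}^d$, $t^{k+1}\ge t^k$, where $t^{k+1}$ is the first component of $A^k(g^1,\dots,g^k)$ and $t^k$ is the first component of $A^{k-1}(g^1,\dots,g^{k-1})$. *)

theory Defs
  imports "HOL-Probability.Probability"
begin

text \<open>
  The dimension is chosen inside the theorem, so it cannot be a type. As in the theory of
  \<^const>\<open>Euclidean_space\<close>, a vector of dimension \<open>d\<close> is a function on \<open>nat\<close> that vanishes from \<open>d\<close>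
  on; coordinates are thus numbered \<open>0, \<dots>, d - 1\<close>. Workers are numbered \<open>1, \<dots>, n\<close>.
\<close>

type_synonym vect = "nat \<Rightarrow> real"

abbreviation Rd :: "nat \<Rightarrow> vect set" where
  "Rd d \<equiv> topspace (Euclidean_space d)"

definition vnorm :: "nat \<Rightarrow> vect \<Rightarrow> real" where
  "vnorm d x = L2_set x {..<d}"

definition supp :: "nat \<Rightarrow> vect \<Rightarrow> nat set" where
  "supp d x = {i. i < d \<and> x i \<noteq> 0}"

definition has_grad :: "nat \<Rightarrow> (vect \<Rightarrow> real) \<Rightarrow> vect \<Rightarrow> vect \<Rightarrow> bool" where
  "has_grad d f G x \<longleftrightarrow> G \<in> Rd d \<and>
     (\<forall>e>0. \<exists>\<delta>>0. \<forall>y\<in>Rd d. vnorm d (y - x) < \<delta> \<longrightarrow>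
        \<bar>f y - f x - (\<Sum>j<d. G j * (y j - x j))\<bar> \<le> e * vnorm d (y - x))"

definition differentiable_Rd :: "nat \<Rightarrow> (vect \<Rightarrow> real) \<Rightarrow> bool" where
  "differentiable_Rd d f \<longleftrightarrow> (\<forall>x\<in>Rd d. \<exists>G. has_grad d f G x)"

definition grad :: "nat \<Rightarrow> (vect \<Rightarrow> real) \<Rightarrow> vect \<Rightarrow> vect" where
  "grad d f x = (THE G. has_grad d f G x)"

definition smooth_with :: "nat \<Rightarrow> real \<Rightarrow> (vect \<Rightarrow> real) \<Rightarrow> bool" where
  "smooth_with d L f \<longleftrightarrow>
     (\<forall>x\<in>Rd d. \<forall>y\<in>Rd d. vnorm d (grad d f x - grad d f y) \<le> L * vnorm d (x - y))"

definition avg :: "nat \<Rightarrow> (nat \<Rightarrow> vect \<Rightarrow> real) \<Rightarrow> vect \<Rightarrow> real" where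
  "avg n F x = (1 / real n) * (\<Sum>i\<in>{1..n}. F i x)"


text \<open>
  Only the values on \<open>[0, \<infinity>)\<close> matter. Integrability on every \<open>[0, t]\<close> says that the integral
  defining \<open>V\<close> exists: almost everywhere continuity alone does not give this, and the library
  integral would be \<open>0\<close> otherwise. The gauge integral used here extends the Riemann integral.
\<close>

definition computation_power :: "(real \<Rightarrow> real) \<Rightarrow> bool" where
  "computation_power v \<longleftrightarrow>
     (\<forall>t\<ge>0. 0 \<le> v t) \<and>
     (AE t in lborel. 0 \<le> t \<longrightarrow> continuous (at t within {0..}) v) \<and>
     (\<forall>t\<ge>0. v integrable_on {0..t})"

definition computation_work :: "(nat \<Rightarrow> real \<Rightarrow> real) \<Rightarrow> nat \<Rightarrow> real \<Rightarrow> real" where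
  "computation_work v i t = integral {0..t} (v i)"


text \<open>
  The \<open>ereal\<close> operations satisfy \<open>inverse 0 = \<infinity>\<close> and \<open>inverse \<infinity> = 0\<close>.
\<close>

definition enough_work ::
  "nat \<Rightarrow> (nat \<Rightarrow> real \<Rightarrow> real) \<Rightarrow> real \<Rightarrow> real \<Rightarrow> real \<Rightarrow> real \<Rightarrow> real \<Rightarrow> real \<Rightarrow> bool" where
  "enough_work n V c2 c3 \<sigma> \<epsilon> s t \<longleftrightarrow>
     inverse (ereal (1 / real n) *
        (\<Sum>i\<in>{1..n}. inverse (ereal (real_of_int \<lfloor>c3 * (V i t - V i s)\<rfloor>))))
     \<ge> ereal (max (c2 * (\<sigma>\<^sup>2 / (real n * \<epsilon>))) 1)"

primrec t_lower ::
  "nat \<Rightarrow> (nat \<Rightarrow> real \<Rightarrow> real) \<Rightarrow> real \<Rightarrow> real \<Rightarrow> real \<Rightarrow> real \<Rightarrow> nat \<Rightarrow> ereal" where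
  "t_lower n V c2 c3 \<sigma> \<epsilon> 0 = 0"
| "t_lower n V c2 c3 \<sigma> \<epsilon> (Suc k) =
     (case t_lower n V c2 c3 \<sigma> \<epsilon> k of
        ereal s \<Rightarrow>
          (if \<exists>t\<ge>0. enough_work n V c2 c3 \<sigma> \<epsilon> s t
           then ereal (LEAST t. 0 \<le> t \<and> enough_work n V c2 c3 \<sigma> \<epsilon> s t)
           else \<infinity>)
      | _ \<Rightarrow> \<infinity>)"


text \<open>
  A state of an \<open>O\<^sub>i\<close> is \<open>(s\<^sub>t, s\<^sub>x, s\<^sub>q)\<close>; the values \<open>0\<close> and \<open>1\<close> of \<open>s\<^sub>q\<close> and of the control are
  \<^const>\<open>False\<close> and \<^const>\<open>True\<close>. The random element \<open>\<xi>\<close> is passed as an argument.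
\<close>

type_synonym oracle_state = "real \<times> vect \<times> bool"

definition init_state :: oracle_state where
  "init_state = (0, (\<lambda>_. 0), False)"

definition query_oracle ::
  "(real \<Rightarrow> real) \<Rightarrow> (vect \<Rightarrow> 'xi \<Rightarrow> real \<Rightarrow> vect) \<Rightarrow>
   real \<Rightarrow> vect \<Rightarrow> oracle_state \<Rightarrow> bool \<Rightarrow> 'xi \<Rightarrow> oracle_state \<times> vect" where
  "query_oracle V g t x s c \<xi> = (case s of (st, sx, sq) \<Rightarrow>
     if c then (init_state, (\<lambda>_. 0))
     else if \<not> sq then ((t, x, True), (\<lambda>_. 0))
     else if V t - V st < 1 then ((st, sx, True), (\<lambda>_. 0))
     else (init_state, g sx \<xi> t))"


text \<open>
  \<open>A [g\<^sup>1, \<dots>, g\<^sup>k]\<close> stands for \<open>A\<^sup>k (g\<^sup>1, \<dots>, g\<^sup>k)\<close>, that is, for \<open>(t\<^sup>k\<^sup>+\<^sup>1, i\<^sup>k\<^sup>+\<^sup>1, c\<^sup>k\<^sup>+\<^sup>1, x\<^sup>k)\<close>.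
\<close>

type_synonym algorithm = "vect list \<Rightarrow> real \<times> nat \<times> bool \<times> vect"

definition zero_respecting :: "nat \<Rightarrow> nat \<Rightarrow> algorithm \<Rightarrow> bool" where
  "zero_respecting d n A \<longleftrightarrow>
     (\<forall>gs. set gs \<subseteq> Rd d \<longrightarrow>
        (case A gs of (t, i, c, x) \<Rightarrow>
           0 \<le> t \<and> i \<in> {1..n} \<and> x \<in> Rd d \<and> supp d x \<subseteq> (\<Union>h\<in>set gs. supp d h))) \<and>
     (\<forall>gs h. set gs \<subseteq> Rd d \<longrightarrow> h \<in> Rd d \<longrightarrow> fst (A gs) \<le> fst (A (gs @ [h])))"


text \<open>
  The state of the protocol after \<open>k\<close> rounds, consisting of \<open>[g\<^sup>1, \<dots>, g\<^sup>k]\<close> and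
  the states of all oracles, as a function of the random elements: round \<open>k\<close> (producing \<open>g\<^sup>k\<^sup>+\<^sup>1\<close>) uses \<open>\<omega> k\<close>.
\<close>

primrec protocol ::
  "(nat \<Rightarrow> real \<Rightarrow> real) \<Rightarrow> (nat \<Rightarrow> vect \<Rightarrow> 'xi \<Rightarrow> real \<Rightarrow> vect) \<Rightarrow> algorithm \<Rightarrow>
   (nat \<Rightarrow> 'xi) \<Rightarrow> nat \<Rightarrow> vect list \<times> (nat \<Rightarrow> oracle_state)" where
  "protocol V g A \<omega> 0 = ([], (\<lambda>_. init_state))"
| "protocol V g A \<omega> (Suc k) = (case protocol V g A \<omega> k of (gs, s) \<Rightarrow>
     case A gs of (t, i, c, x) \<Rightarrow>
     case query_oracle (V i) (g i) t x (s i) c (\<omega> k) of (si, h) \<Rightarrow>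
       (gs @ [h], s(i := si)))"

definition protocol_point ::
  "(nat \<Rightarrow> real \<Rightarrow> real) \<Rightarrow> (nat \<Rightarrow> vect \<Rightarrow> 'xi \<Rightarrow> real \<Rightarrow> vect) \<Rightarrow> algorithm \<Rightarrow>
   (nat \<Rightarrow> 'xi) \<Rightarrow> nat \<Rightarrow> vect" where
  "protocol_point V g A \<omega> k =
     (case A (fst (protocol V g A \<omega> k)) of (t, i, c, x) \<Rightarrow> x)"

definition protocol_time ::
  "(nat \<Rightarrow> real \<Rightarrow> real) \<Rightarrow> (nat \<Rightarrow> vect \<Rightarrow> 'xi \<Rightarrow> real \<Rightarrow> vect) \<Rightarrow> algorithm \<Rightarrow>
   (nat \<Rightarrow> 'xi) \<Rightarrow> nat \<Rightarrow> real" where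
  "protocol_time V g A \<omega> k =
     (case k of 0 \<Rightarrow> 0 | Suc j \<Rightarrow> fst (A (fst (protocol V g A \<omega> j))))"


text \<open>
  The conditional law of \<open>\<omega> k\<close> given \<open>\<omega> 0, \<dots>, \<omega> (k - 1)\<close> is the distribution
  \<open>\<D>\<close> for the stored point of the called \<open>O\<^sub>i\<close>, the query time and the worker. A fresh element is
  drawn in every round; it is used only if the call returns a stochastic gradient. The law of the
  whole sequence \<open>\<omega>\<close> is the one given by the Ionescu-Tulcea theorem.
\<close>

definition noise_kernel ::
  "(nat \<Rightarrow> real \<Rightarrow> real) \<Rightarrow> (nat \<Rightarrow> vect \<Rightarrow> real \<Rightarrow> 'xi measure) \<Rightarrow>
   (nat \<Rightarrow> vect \<Rightarrow> 'xi \<Rightarrow> real \<Rightarrow> vect) \<Rightarrow> algorithm \<Rightarrow>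
   nat \<Rightarrow> (nat \<Rightarrow> 'xi) \<Rightarrow> 'xi measure" where
  "noise_kernel V D g A k \<omega> = (case protocol V g A \<omega> k of (gs, s) \<Rightarrow>
     case A gs of (t, i, c, x) \<Rightarrow>
     case s i of (st, sx, sq) \<Rightarrow> D i sx t)"

definition noise_law ::
  "(nat \<Rightarrow> real \<Rightarrow> real) \<Rightarrow> 'xi measure \<Rightarrow> (nat \<Rightarrow> vect \<Rightarrow> real \<Rightarrow> 'xi measure) \<Rightarrow>
   (nat \<Rightarrow> vect \<Rightarrow> 'xi \<Rightarrow> real \<Rightarrow> vect) \<Rightarrow> algorithm \<Rightarrow> (nat \<Rightarrow> 'xi) measure" where
  "noise_law V N D g A =
     projective_family.lim UNIV
       (Ionescu_Tulcea.CI (noise_kernel V D g A) (\<lambda>_. N)) (\<lambda>_. N)"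


text \<open>
  \<open>N\<close> is the measurable space carrying all distributions \<open>D i x t\<close>; only its \<open>\<sigma>\<close>-algebra is used.
\<close>

definition stochastic_gradients ::
  "nat \<Rightarrow> nat \<Rightarrow> real \<Rightarrow> (nat \<Rightarrow> vect \<Rightarrow> real) \<Rightarrow> 'xi measure \<Rightarrow>
   (nat \<Rightarrow> vect \<Rightarrow> real \<Rightarrow> 'xi measure) \<Rightarrow> (nat \<Rightarrow> vect \<Rightarrow> 'xi \<Rightarrow> real \<Rightarrow> vect) \<Rightarrow> bool" where
  "stochastic_gradients d n \<sigma> F N D g \<longleftrightarrow>
     (\<forall>i\<in>{1..n}. \<forall>x\<in>Rd d. \<forall>t\<ge>0.
        prob_space (D i x t) \<and> sets (D i x t) = sets N \<and>
        (\<forall>\<xi>\<in>space N. g i x \<xi> t \<in> Rd d) \<and>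
        (\<forall>j<d. integrable (D i x t) (\<lambda>\<xi>. g i x \<xi> t j) \<and>
               (\<integral>\<xi>. g i x \<xi> t j \<partial>D i x t) = grad d (F i) x j) \<and>
        integrable (D i x t) (\<lambda>\<xi>. (vnorm d (g i x \<xi> t - grad d (F i) x))\<^sup>2) \<and>
        (\<integral>\<xi>. (vnorm d (g i x \<xi> t - grad d (F i) x))\<^sup>2 \<partial>D i x t) \<le> \<sigma>\<^sup>2)"

definition best_grad_norm ::
  "nat \<Rightarrow> (vect \<Rightarrow> real) \<Rightarrow> (nat \<Rightarrow> real \<Rightarrow> real) \<Rightarrow>
   (nat \<Rightarrow> vect \<Rightarrow> 'xi \<Rightarrow> real \<Rightarrow> vect) \<Rightarrow> algorithm \<Rightarrow> ereal \<Rightarrow> (nat \<Rightarrow> 'xi) \<Rightarrow> real" where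
  "best_grad_norm d f V g A t \<omega> =
     (INF k\<in>{k. ereal (protocol_time V g A \<omega> k) \<le> t}.
        (vnorm d (grad d f (protocol_point V g A \<omega> k)))\<^sup>2)"

end

theory Submission
  imports Defs
begin

text \<open>
  The instance is deterministic. The function is a chain of stages, one for each period
  \<open>[\<tau>\<^sub>m\<^sub>-\<^sub>1, \<tau>\<^sub>m)\<close>; a stage can be entered only through a gate that opens when more than a quarter of
  the weight of the previous stage has been climbed, and the gradient stays large until the last
  gate is fully open. Inside stage \<open>m\<close> worker \<open>i\<close> holds the fraction \<open>w m i\<close>, inversely proportional
  to the work that it can do during the period (everything, if it cannot do any), and this fraction
  is spread over \<open>B m i\<close> coordinates. The variance bound permits an unbiased gradient that shows one
  uniformly chosen coordinate out of \<open>B m i \<approx> \<sigma>\<^sup>2 / (32 n\<^sup>2 \<epsilon> w m i)\<close>, scaled by \<open>B m i\<close>. Each job thus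
  reveals at most one coordinate, and as the harmonic mean of the available work is too small before
  \<open>\<tau>\<^sub>m\<close>, at most a quarter of the weight of the stage is revealed by then. This holds for every outcome
  of the noise, so no concentration argument is needed.
\<close>

subsection \<open>Gradients on \<open>Rd d\<close>\<close>

text \<open>Two obstacles shape the construction. The variance bound must hold at every point, also
  where several gates are open, so only one stage may carry noise. It is the stage behind an open
  gate with all its own and later gates closed, as read off from the point. This hides enough: while
  period \<open>m\<close> lasts, the gates from \<open>m\<close> on are closed at every stored
  point, so an unseen coordinate of stage \<open>m\<close> with nonzero derivative lies in that
  stage. Secondly, an answer refers to the point stored when its job started. A job started before
  period \<open>m\<close> saw gate \<open>m - 1\<close> closed and reveals nothing of stage
  \<open>m\<close>; hence only jobs that start within the period count, and each of them consumes
  one unit of its work.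

  Constants: the unscaled chain has a 256-Lipschitz gradient, is bounded below by \<open>-K\<close>,
  and has squared gradient norm at least 1/64 until the last gate is fully open. The scale
  \<open>lam\<close> turns these into \<open>L\<close>, \<open>-32768 \<epsilon> K / L\<close> and
  \<open>2 \<epsilon>\<close>, whence \<open>c' = c1 = 1/32768\<close>. The factor 32 in the
  variance is \<open>128 / 4\<close>, a squared slope 1/2 at scale \<open>128 \<epsilon>\<close>;
  \<open>c3 = 4 * 32\<close> makes the revealed weight a quarter.\<close>

lemma vnorm_sq: "(vnorm d x)\<^sup>2 = (\<Sum>c<d. (x c)\<^sup>2)"
  by (simp add: vnorm_def L2_set_def sum_nonneg)

lemma vnorm_nonneg: "0 \<le> vnorm d x"
  by (simp add: vnorm_def)

lemma inner_le_vnorm: "\<bar>\<Sum>j<d. G j * h j\<bar> \<le> vnorm d G * vnorm d h"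
proof -
  have "\<bar>\<Sum>j<d. G j * h j\<bar> \<le> (\<Sum>j<d. \<bar>G j\<bar> * \<bar>h j\<bar>)"
    by (metis (mono_tags, lifting) abs_mult sum.cong sum_abs)
  also have "\<dots> \<le> vnorm d G * vnorm d h"
    unfolding vnorm_def by (rule L2_set_mult_ineq)
  finally show ?thesis .
qed

lemma in_Rd: "x \<in> Rd d \<longleftrightarrow> (\<forall>i\<ge>d. x i = 0)"
  by (simp add: topspace_Euclidean_space)

lemma has_grad_const: "has_grad d (\<lambda>_. k) (\<lambda>_. 0) x"
  by (auto simp: has_grad_def in_Rd vnorm_nonneg intro: exI[of _ 1])

lemma has_grad_coord:
  assumes "c < d"
  shows "has_grad d (\<lambda>y. y c) (\<lambda>j. if j = c then 1 else 0) x"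
proof -
  have "(\<Sum>j<d. (if j = c then 1 else 0) * (y j - x j)) = y c - x c" for y
    using assms by (simp add: if_distrib[where f="\<lambda>u. u * _"] cong: if_cong)
  then show ?thesis
    using assms by (auto simp: has_grad_def in_Rd vnorm_nonneg intro: exI[of _ 1])
qed

lemma has_grad_add:
  assumes "has_grad d f G x" "has_grad d h H x"
  shows "has_grad d (\<lambda>y. f y + h y) (\<lambda>j. G j + H j) x"
  unfolding has_grad_def
proof (intro conjI allI impI)
  show "(\<lambda>j. G j + H j) \<in> Rd d"
    using assms by (auto simp: has_grad_def in_Rd)
  fix e :: real assume "e > 0"
  then have e2: "e / 2 > 0" by simp
  from assms(1) e2 obtain \<delta>1 where 1: "\<delta>1 > 0" "\<And>y. y \<in> Rd d \<Longrightarrow> vnorm d (y - x) < \<delta>1 \<Longrightarrow>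
      \<bar>f y - f x - (\<Sum>j<d. G j * (y j - x j))\<bar> \<le> e / 2 * vnorm d (y - x)"
    unfolding has_grad_def by blast
  from assms(2) e2 obtain \<delta>2 where 2: "\<delta>2 > 0" "\<And>y. y \<in> Rd d \<Longrightarrow> vnorm d (y - x) < \<delta>2 \<Longrightarrow>
      \<bar>h y - h x - (\<Sum>j<d. H j * (y j - x j))\<bar> \<le> e / 2 * vnorm d (y - x)"
    unfolding has_grad_def by blast
  show "\<exists>\<delta>>0. \<forall>y\<in>Rd d. vnorm d (y - x) < \<delta> \<longrightarrow>
      \<bar>f y + h y - (f x + h x) - (\<Sum>j<d. (G j + H j) * (y j - x j))\<bar> \<le> e * vnorm d (y - x)"
  proof (intro exI[of _ "min \<delta>1 \<delta>2"] conjI ballI impI)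
    fix y assume y: "y \<in> Rd d" "vnorm d (y - x) < min \<delta>1 \<delta>2"
    have "(\<Sum>j<d. (G j + H j) * (y j - x j))
        = (\<Sum>j<d. G j * (y j - x j)) + (\<Sum>j<d. H j * (y j - x j))"
      by (simp add: distrib_right sum.distrib)
    moreover have "\<bar>f y - f x - (\<Sum>j<d. G j * (y j - x j))\<bar> \<le> e / 2 * vnorm d (y - x)"
      "\<bar>h y - h x - (\<Sum>j<d. H j * (y j - x j))\<bar> \<le> e / 2 * vnorm d (y - x)"
      using 1(2)[OF y(1)] 2(2)[OF y(1)] y(2) by auto
    ultimately show "\<bar>f y + h y - (f x + h x) - (\<Sum>j<d. (G j + H j) * (y j - x j))\<bar>
        \<le> e * vnorm d (y - x)"
      by linarith
  qed (use 1 2 in auto)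
qed

lemma has_grad_compose:
  assumes f: "has_grad d f G x" and h: "(h has_real_derivative D) (at (f x))"
  shows "has_grad d (\<lambda>y. h (f y)) (\<lambda>j. D * G j) x"
  unfolding has_grad_def
proof (intro conjI allI impI)
  show "(\<lambda>j. D * G j) \<in> Rd d"
    using f by (auto simp: has_grad_def in_Rd)
  fix e :: real assume e: "e > 0"
  define C where "C = vnorm d G + 1"
  have C: "C > 0" using vnorm_nonneg[of d G] by (simp add: C_def)
  define e1 where "e1 = e / (2 * C)"
  define M where "M = \<bar>D\<bar> + 1"
  have M: "M > 0" by (simp add: M_def)
  \<comment> \<open>The bound 1 yields
    \<open>\<bar>f y - f x\<bar> \<le> C * vnorm d (y - x)\<close>; the other bound makes
    \<open>D\<close> times the remainder of \<open>f\<close> at most half of the allowed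
    error.\<close>
  define e2 where "e2 = min 1 (e / (2 * M))"
  have e12: "e1 > 0" "e2 > 0" using e C M by (auto simp: e1_def e2_def)
  from h e12(1) obtain \<delta>1 where 1: "\<delta>1 > 0" "\<And>z. \<bar>z - f x\<bar> < \<delta>1 \<Longrightarrow>
      \<bar>h z - h (f x) - D * (z - f x)\<bar> \<le> e1 * \<bar>z - f x\<bar>"
    unfolding has_field_derivative_def has_derivative_at_alt by (auto simp: mult.commute)
  from f e12(2) obtain \<delta>2 where 2: "\<delta>2 > 0" "\<And>y. y \<in> Rd d \<Longrightarrow> vnorm d (y - x) < \<delta>2 \<Longrightarrow>
      \<bar>f y - f x - (\<Sum>j<d. G j * (y j - x j))\<bar> \<le> e2 * vnorm d (y - x)"
    unfolding has_grad_def by blast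
  show "\<exists>\<delta>>0. \<forall>y\<in>Rd d. vnorm d (y - x) < \<delta> \<longrightarrow>
      \<bar>h (f y) - h (f x) - (\<Sum>j<d. D * G j * (y j - x j))\<bar> \<le> e * vnorm d (y - x)"
  proof (intro exI[of _ "min (\<delta>1 / C) \<delta>2"] conjI ballI impI)
    fix y assume y: "y \<in> Rd d" "vnorm d (y - x) < min (\<delta>1 / C) \<delta>2"
    let ?v = "vnorm d (y - x)" and ?l = "\<Sum>j<d. G j * (y j - x j)"
    have r: "\<bar>f y - f x - ?l\<bar> \<le> e2 * ?v" using 2(2) y by simp
    moreover have "\<bar>?l\<bar> \<le> vnorm d G * ?v"
      using inner_le_vnorm[where G=G and h="y - x" and d=d] by simp
    moreover have "e2 * ?v \<le> 1 * ?v"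
      by (intro mult_right_mono) (auto simp: e2_def vnorm_nonneg)
    ultimately have df: "\<bar>f y - f x\<bar> \<le> C * ?v" by (simp add: C_def algebra_simps)
    also have "\<dots> < \<delta>1" using y C by (simp add: field_simps)
    finally have "\<bar>h (f y) - h (f x) - D * (f y - f x)\<bar> \<le> e1 * \<bar>f y - f x\<bar>" by (rule 1(2))
    also have "\<dots> \<le> e1 * (C * ?v)" using df e12 by (intro mult_left_mono) auto
    also have "\<dots> = e / 2 * ?v" using C by (simp add: e1_def)
    finally have a: "\<bar>h (f y) - h (f x) - D * (f y - f x)\<bar> \<le> e / 2 * ?v" .
    have "\<bar>D * (f y - f x - ?l)\<bar> \<le> \<bar>D\<bar> * (e2 * ?v)"
      using r by (simp add: abs_mult mult_left_mono)
    also have "\<dots> \<le> M * (e / (2 * M) * ?v)"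
    proof (rule mult_mono)
      show "e2 * ?v \<le> e / (2 * M) * ?v"
        by (rule mult_right_mono) (auto simp: e2_def vnorm_nonneg)
      show "\<bar>D\<bar> \<le> M" by (simp add: M_def)
      show "0 \<le> e2 * ?v" using e12 by (simp add: vnorm_nonneg)
    qed (use M in simp)
    also have "\<dots> = e / 2 * ?v" using M by simp
    finally have "\<bar>D * (f y - f x) - D * ?l\<bar> \<le> e / 2 * ?v"
      by (simp add: right_diff_distrib)
    moreover have "(\<Sum>j<d. D * G j * (y j - x j)) = D * ?l"
      by (simp add: sum_distrib_left mult.assoc)
    ultimately show "\<bar>h (f y) - h (f x) - (\<Sum>j<d. D * G j * (y j - x j))\<bar> \<le> e * ?v"
      using a by linarith
  qed (use 1 2 C in auto)
qed

lemma has_grad_cmult: "has_grad d f G x \<Longrightarrow> has_grad d (\<lambda>y. k * f y) (\<lambda>j. k * G j) x"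
  by (rule has_grad_compose[where h="\<lambda>z. k * z"]) (auto intro!: derivative_eq_intros)

lemma has_grad_diff:
  "has_grad d f G x \<Longrightarrow> has_grad d h H x \<Longrightarrow> has_grad d (\<lambda>y. f y - h y) (\<lambda>j. G j - H j) x"
  using has_grad_add[of d f G x "\<lambda>y. -1 * h y" "\<lambda>j. -1 * H j"] has_grad_cmult[of d h H x "-1"]
  by simp

lemma has_grad_mult:
  assumes f: "has_grad d f G x" and h: "has_grad d h H x"
  shows "has_grad d (\<lambda>y. f y * h y) (\<lambda>j. f x * H j + h x * G j) x"
proof -
  \<comment> \<open>Polarization reduces products to the chain rule for squares.\<close>
  have sq: "((\<lambda>z. z\<^sup>2 / 4) has_real_derivative a / 2) (at a)" for a :: real
    by (auto intro!: derivative_eq_intros)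
  have "has_grad d (\<lambda>y. (f y + h y)\<^sup>2 / 4 - (f y - h y)\<^sup>2 / 4)
      (\<lambda>j. (f x + h x) / 2 * (G j + H j) - (f x - h x) / 2 * (G j - H j)) x"
    by (intro has_grad_diff has_grad_compose[OF has_grad_add[OF f h] sq]
          has_grad_compose[OF has_grad_diff[OF f h] sq])
  moreover have "(\<lambda>y. (f y + h y)\<^sup>2 / 4 - (f y - h y)\<^sup>2 / 4) = (\<lambda>y. f y * h y)"
    by (auto simp: power2_eq_square field_simps)
  moreover have "(\<lambda>j. (f x + h x) / 2 * (G j + H j) - (f x - h x) / 2 * (G j - H j))
      = (\<lambda>j. f x * H j + h x * G j)"
    by (auto simp: field_simps)
  ultimately show ?thesis by simp
qed

lemma has_grad_sum:
  assumes "finite I" "\<And>c. c \<in> I \<Longrightarrow> has_grad d (f c) (G c) x"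
  shows "has_grad d (\<lambda>y. \<Sum>c\<in>I. f c y) (\<lambda>j. \<Sum>c\<in>I. G c j) x"
  using assms by (induction I) (auto intro: has_grad_const has_grad_add)

lemma has_grad_scale:
  assumes l: "l > 0" and f: "has_grad d f G (\<lambda>j. x j / l)"
  shows "has_grad d (\<lambda>y. f (\<lambda>j. y j / l)) (\<lambda>j. G j / l) x"
  unfolding has_grad_def
proof (intro conjI allI impI)
  show "(\<lambda>j. G j / l) \<in> Rd d"
    using f by (auto simp: has_grad_def in_Rd)
  fix e :: real assume "e > 0"
  then have "e * l > 0" using l by simp
  with f obtain \<delta> where \<delta>: "\<delta> > 0" "\<And>y. y \<in> Rd d \<Longrightarrow> vnorm d (y - (\<lambda>j. x j / l)) < \<delta> \<Longrightarrow>
      \<bar>f y - f (\<lambda>j. x j / l) - (\<Sum>j<d. G j * (y j - x j / l))\<bar> \<le> e * l * vnorm d (y - (\<lambda>j. x j / l))"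
    unfolding has_grad_def by blast
  show "\<exists>\<delta>>0. \<forall>y\<in>Rd d. vnorm d (y - x) < \<delta> \<longrightarrow>
      \<bar>f (\<lambda>j. y j / l) - f (\<lambda>j. x j / l) - (\<Sum>j<d. G j / l * (y j - x j))\<bar> \<le> e * vnorm d (y - x)"
  proof (intro exI[of _ "\<delta> * l"] conjI ballI impI)
    fix y assume y: "y \<in> Rd d" "vnorm d (y - x) < \<delta> * l"
    have "(vnorm d ((\<lambda>j. y j / l) - (\<lambda>j. x j / l)))\<^sup>2 = (vnorm d (y - x) / l)\<^sup>2"
      by (simp add: vnorm_sq power_divide flip: diff_divide_distrib sum_divide_distrib)
    then have v: "vnorm d ((\<lambda>j. y j / l) - (\<lambda>j. x j / l)) = vnorm d (y - x) / l"
      using l by (simp add: power2_eq_iff_nonneg vnorm_nonneg)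
    have s: "(\<Sum>j<d. G j / l * (y j - x j)) = (\<Sum>j<d. G j * (y j / l - x j / l))"
      by (intro sum.cong) (auto simp: diff_divide_distrib algebra_simps)
    have "(\<lambda>j. y j / l) \<in> Rd d" using y(1) by (auto simp: in_Rd)
    from \<delta>(2)[OF this] y(2) l
    show "\<bar>f (\<lambda>j. y j / l) - f (\<lambda>j. x j / l) - (\<Sum>j<d. G j / l * (y j - x j))\<bar> \<le> e * vnorm d (y - x)"
      unfolding v s by (simp add: field_simps)
  qed (use \<delta> l in auto)
qed

text \<open>The zero function has gradient \<open>G - H\<close> at \<open>x\<close>; moving along a
  single coordinate shows that each entry is arbitrarily small. This justifies the definite
  description in \<open>grad\<close>.\<close>

lemma has_grad_unique:
  assumes G: "has_grad d f G x" and H: "has_grad d f H x" and x: "x \<in> Rd d"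
  shows "G = H"
proof
  fix c
  have 0: "has_grad d (\<lambda>_. 0) (\<lambda>j. G j - H j) x"
    using has_grad_diff[OF G H] by simp
  show "G c = H c"
  proof (cases "c < d")
    case True
    have "\<bar>G c - H c\<bar> \<le> e" if "e > 0" for e :: real
    proof -
      from 0 \<open>e > 0\<close> obtain \<delta> where \<delta>: "\<delta> > 0" "\<And>y. y \<in> Rd d \<Longrightarrow> vnorm d (y - x) < \<delta> \<Longrightarrow>
          \<bar>\<Sum>j<d. (G j - H j) * (y j - x j)\<bar> \<le> e * vnorm d (y - x)"
        unfolding has_grad_def by fastforce
      define y where "y = x(c := x c + \<delta> / 2)"
      have yx: "y j - x j = (if j = c then \<delta> / 2 else 0)" for j by (simp add: y_def)
      have "(vnorm d (y - x))\<^sup>2 = (\<delta> / 2)\<^sup>2"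
        using True by (simp add: vnorm_sq yx if_distrib[where f="\<lambda>u. u\<^sup>2"] cong: if_cong)
      then have v: "vnorm d (y - x) = \<delta> / 2"
        using \<delta>(1) by (simp add: power2_eq_iff_nonneg vnorm_nonneg)
      have sum: "(\<Sum>j<d. (G j - H j) * (y j - x j)) = (G c - H c) * (\<delta> / 2)"
        using True by (simp add: yx if_distrib[where f="\<lambda>u. _ * u"] cong: if_cong)
      have "y \<in> Rd d" using x True by (auto simp: y_def in_Rd)
      then have "\<bar>(G c - H c) * (\<delta> / 2)\<bar> \<le> e * (\<delta> / 2)"
        using \<delta>(2)[of y] \<delta>(1) unfolding sum v by simp
      then show ?thesis using \<delta>(1) by (simp add: abs_mult)
    qed
    then show ?thesis by (metis abs_ge_zero abs_le_zero_iff dense_ge eq_iff_diff_eq_0)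
  qed (use G H in \<open>auto simp: has_grad_def in_Rd\<close>)
qed

lemma grad_eq: "has_grad d f G x \<Longrightarrow> x \<in> Rd d \<Longrightarrow> grad d f x = G"
  unfolding grad_def by (rule the_equality) (auto dest: has_grad_unique)

subsection \<open>Cut-off functions\<close>

text \<open>The remainder is at most \<open>(y - x)^2\<close> for all signs of \<open>x\<close> and
  \<open>y\<close>, so the kink at 0 needs no separate limit and the radius can be taken equal to
  \<open>e\<close>.\<close>

lemma DERIV_pos_part_sq: "((\<lambda>x::real. (max 0 x)\<^sup>2) has_real_derivative 2 * max 0 x) (at x)"
  unfolding has_field_derivative_def has_derivative_at_alt
proof (intro conjI allI impI bounded_linear_mult_right exI)
  fix e y :: real assume e: "0 < e" and y: "norm (y - x) < e"
  have "\<bar>(max 0 y)\<^sup>2 - (max 0 x)\<^sup>2 - 2 * max 0 x * (y - x)\<bar> \<le> (y - x)\<^sup>2"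
  proof (cases "0 \<le> x \<longleftrightarrow> 0 \<le> y")
    case True
    then show ?thesis
    proof (cases "0 \<le> x")
      case pos: True
      have "y\<^sup>2 - x\<^sup>2 - 2 * x * (y - x) = (y - x)\<^sup>2"
        by (simp add: power2_eq_square algebra_simps)
      with pos True show ?thesis by simp
    qed (use True in simp)
  next
    case False
    then have "x * y \<le> 0" by (auto simp: mult_le_0_iff)
    moreover from this have "\<bar>x * x - x * (y * 2)\<bar> = x * x - x * (y * 2)"
      using zero_le_square[of x] by (intro abs_of_nonneg) linarith
    ultimately show ?thesis
      using False by (auto simp: max_def power2_eq_square algebra_simps)
  qed
  also have "\<dots> \<le> e * \<bar>y - x\<bar>"
    using y by (metis abs_ge_zero less_eq_real_def mult_right_mono power2_abs power2_eq_square real_norm_def)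
  finally show "norm ((max 0 y)\<^sup>2 - (max 0 x)\<^sup>2 - 2 * max 0 x * (y - x)) \<le> e * norm (y - x)"
    by simp
qed

text \<open>A continuously differentiable step from 0 to 1 on the unit interval. It is a second
  difference of squared positive parts, so its derivative is the tent function \<open>ramp'\<close>
  with peak 2 at 1/2. It is flat on the negative axis including 0.\<close>

definition ramp :: "real \<Rightarrow> real" where
  "ramp x = 2 * ((max 0 x)\<^sup>2 - 2 * (max 0 (x - 1/2))\<^sup>2 + (max 0 (x - 1))\<^sup>2)"

definition ramp' :: "real \<Rightarrow> real" where
  "ramp' x = 4 * max 0 (min x (1 - x))"

lemma DERIV_ramp: "(ramp has_real_derivative ramp' x) (at x)"
proof -
  have "((\<lambda>x. (max 0 (x - a))\<^sup>2) has_real_derivative 2 * max 0 (x - a)) (at x)" for a :: real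
    using DERIV_pos_part_sq[of "x - a"] DERIV_shift[of "\<lambda>x. (max 0 x)\<^sup>2" "2 * max 0 (x - a)" x "- a"]
    by simp
  from this[of 0] this[of "1/2"] this[of 1]
  have "(ramp has_real_derivative
      2 * (2 * max 0 x - 2 * (2 * max 0 (x - 1/2)) + 2 * max 0 (x - 1))) (at x)"
    unfolding ramp_def[abs_def] by (intro DERIV_cmult DERIV_add DERIV_diff) simp_all
  moreover have "2 * (2 * max 0 x - 2 * (2 * max 0 (x - 1/2)) + 2 * max 0 (x - 1)) = ramp' x"
    by (auto simp: ramp'_def max_def min_def)
  ultimately show ?thesis by simp
qed

lemma ramp'_nonneg: "0 \<le> ramp' x" and ramp'_le: "ramp' x \<le> 2"
  by (auto simp: ramp'_def max_def min_def)

lemma ramp'_lipschitz: "\<bar>ramp' x - ramp' y\<bar> \<le> 4 * \<bar>x - y\<bar>"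
  by (auto simp: ramp'_def max_def min_def abs_if)

lemma ramp_eq_0: "x \<le> 0 \<Longrightarrow> ramp x = 0" and ramp'_eq_0: "x \<le> 0 \<Longrightarrow> ramp' x = 0"
  by (auto simp: ramp_def ramp'_def)

lemma ramp_eq_1: "x \<ge> 1 \<Longrightarrow> ramp x = 1"
  by (auto simp: ramp_def power2_eq_square algebra_simps)

lemma ramp_mono: "x \<le> y \<Longrightarrow> ramp x \<le> ramp y"
  by (rule DERIV_nonneg_imp_nondecreasing) (use DERIV_ramp ramp'_nonneg in blast)+

lemma ramp_nonneg: "0 \<le> ramp x" and ramp_le_1: "ramp x \<le> 1"
  using ramp_mono[of "min 0 x" x] ramp_eq_0[of "min 0 x"]
    ramp_mono[of x "max 1 x"] ramp_eq_1[of "max 1 x"] by auto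

lemma ramp_lipschitz: "\<bar>ramp x - ramp y\<bar> \<le> 2 * \<bar>x - y\<bar>"
  using field_differentiable_bound[of UNIV ramp ramp' 2 x y] DERIV_ramp ramp'_nonneg ramp'_le
  by auto

text \<open>The same step stretched to the interval from -2 to 2. In contrast to
  \<open>ramp\<close>, which governs the gates, it is steepest at 0: an untouched coordinate has a
  nonzero derivative but does not open anything.\<close>

definition climb :: "real \<Rightarrow> real" where
  "climb y = ramp ((y + 2) / 4)"

definition climb' :: "real \<Rightarrow> real" where
  "climb' y = ramp' ((y + 2) / 4) / 4"

definition wall :: "real \<Rightarrow> real" where
  "wall y = (max 0 (- y))\<^sup>2 / 2"

lemma DERIV_climb: "(climb has_real_derivative climb' y) (at y)"
proof -
  have "((\<lambda>y. (y + 2) / 4) has_real_derivative 1 / 4) (at y)"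
    by (auto intro!: derivative_eq_intros)
  from DERIV_chain2[OF DERIV_ramp this] show ?thesis
    by (simp add: climb_def[abs_def] climb'_def)
qed

lemma DERIV_wall: "(wall has_real_derivative min y 0) (at y)"
proof -
  have "((\<lambda>y. - y) has_real_derivative - 1) (at y)"
    by (auto intro!: derivative_eq_intros)
  from DERIV_cdivide[OF DERIV_chain2[OF DERIV_pos_part_sq this], of 2] show ?thesis
    by (simp add: wall_def[abs_def] max_def min_def split: if_splits)
qed

lemma climb_bounds: "0 \<le> climb y" "climb y \<le> 1"
  by (simp_all add: climb_def ramp_nonneg ramp_le_1)

lemma climb'_bounds: "0 \<le> climb' y" "climb' y \<le> 1 / 2"
  using ramp'_nonneg[of "(y + 2) / 4"] ramp'_le[of "(y + 2) / 4"] by (simp_all add: climb'_def)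

lemma climb_lipschitz: "\<bar>climb y - climb z\<bar> \<le> \<bar>y - z\<bar> / 2"
proof -
  have q: "(y + 2) / 4 - (z + 2) / 4 = (y - z) / 4" by (simp add: field_simps)
  show ?thesis
    using ramp_lipschitz[of "(y + 2) / 4" "(z + 2) / 4"] unfolding climb_def q by simp
qed

lemma climb'_lipschitz: "\<bar>climb' y - climb' z\<bar> \<le> \<bar>y - z\<bar> / 4"
proof -
  have q: "(y + 2) / 4 - (z + 2) / 4 = (y - z) / 4" by (simp add: field_simps)
  show ?thesis
    using ramp'_lipschitz[of "(y + 2) / 4" "(z + 2) / 4"] unfolding climb'_def q diff_divide_distrib[symmetric] by simp
qed

lemma climb'_0: "climb' 0 = 1 / 2"
  by (simp add: climb'_def ramp'_def)

lemma climb'_ge: "\<bar>y\<bar> \<le> 1 \<Longrightarrow> 1 / 4 \<le> climb' y"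
  by (auto simp: climb'_def ramp'_def min_def max_def abs_le_iff)

lemma abs_mult_diff_le:
  fixes a b a' b' :: real
  assumes "\<bar>a\<bar> \<le> A" "\<bar>b'\<bar> \<le> B" "\<bar>a - a'\<bar> \<le> p" "\<bar>b - b'\<bar> \<le> q"
  shows "\<bar>a * b - a' * b'\<bar> \<le> A * q + B * p"
proof -
  have "a * b - a' * b' = a * (b - b') + b' * (a - a')" by (simp add: algebra_simps)
  also have "\<bar>\<dots>\<bar> \<le> \<bar>a\<bar> * \<bar>b - b'\<bar> + \<bar>b'\<bar> * \<bar>a - a'\<bar>"
    by (metis abs_mult abs_triangle_ineq)
  also have "\<dots> \<le> A * q + B * p"
    using assms by (intro add_mono mult_mono) auto
  finally show ?thesis .
qed

subsection \<open>The chain of stages\<close>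

text \<open>
  Coordinate \<open>c\<close> belongs to stage \<open>st c\<close> and carries the weight \<open>(al c)\<^sup>2\<close> in it. The term with
  \<open>wall\<close> keeps the gradient large at points that escape to negative coordinates.
\<close>

locale chain =
  fixes d K :: nat and st :: "nat \<Rightarrow> nat" and al :: "nat \<Rightarrow> real"
  assumes al_pos: "c < d \<Longrightarrow> 0 < al c"
    and st_range: "c < d \<Longrightarrow> st c \<in> {1..K}"
    and stage_weight: "m \<in> {1..K} \<Longrightarrow> (\<Sum>c | c < d \<and> st c = m. (al c)\<^sup>2) = 1"
begin

definition blk :: "nat \<Rightarrow> nat set" where
  "blk m = {c. c < d \<and> st c = m}"

definition progress :: "nat \<Rightarrow> vect \<Rightarrow> real" where
  "progress m x = (\<Sum>c\<in>blk m. (al c)\<^sup>2 * ramp (x c / al c))"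

text \<open>Closed up to progress 1/4 and fully open from progress 3/4 on. Stage 0 has no
  coordinates; its gate is always open and gives access to stage 1.\<close>

definition gate :: "nat \<Rightarrow> vect \<Rightarrow> real" where
  "gate m x = (if m = 0 then 1 else ramp (2 * progress m x - 1 / 2))"

definition gate' :: "nat \<Rightarrow> vect \<Rightarrow> real" where
  "gate' m x = (if m = 0 then 0 else 2 * ramp' (2 * progress m x - 1 / 2))"

definition reward :: "nat set \<Rightarrow> nat \<Rightarrow> vect \<Rightarrow> real" where
  "reward I m x = (\<Sum>c\<in>I \<inter> blk m. (al c)\<^sup>2 * climb (x c / al c))"

text \<open>Additive in \<open>I\<close>, so that the workers can hold disjoint sets of terms of one
  chain. The gates still depend on the coordinates of all workers.\<close>

definition obj :: "nat set \<Rightarrow> vect \<Rightarrow> real" where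
  "obj I x = (\<Sum>c\<in>I. (al c)\<^sup>2 * (wall (x c / al c) - gate (st c - 1) x * climb (x c / al c)))"

text \<open>The last term is not confined to \<open>c \<in> I\<close>: by the product rule, a
  coordinate of any worker influences the gate in front of the terms of \<open>I\<close> in the next
  stage.\<close>

definition gobj :: "nat set \<Rightarrow> vect \<Rightarrow> vect" where
  "gobj I x c = (if c < d then al c *
     ((if c \<in> I then min (x c / al c) 0 - gate (st c - 1) x * climb' (x c / al c) else 0)
      - gate' (st c) x * ramp' (x c / al c) * reward I (st c + 1) x) else 0)"

section \<open>The gradient of the chain\<close>

lemma finite_blk: "finite (blk m)"
  by (simp add: blk_def)

lemma has_grad_sep:
  assumes c: "c < d" and h: "(h has_real_derivative h') (at (x c / al c))"
  shows "has_grad d (\<lambda>y. (al c)\<^sup>2 * h (y c / al c)) (\<lambda>j. al c * h' * (if j = c then 1 else 0)) x"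
proof -
  have "((\<lambda>z. (al c)\<^sup>2 * h (z / al c)) has_real_derivative (al c)\<^sup>2 * (h' * (1 / al c))) (at (x c))"
    by (intro DERIV_cmult DERIV_chain2[where f=h and g="\<lambda>z. z / al c", OF h])
      (use al_pos[OF c] in \<open>auto intro!: derivative_eq_intros\<close>)
  also have "(al c)\<^sup>2 * (h' * (1 / al c)) = al c * h'"
    using al_pos[OF c] by (simp add: power2_eq_square)
  finally show ?thesis
    by (rule has_grad_compose[OF has_grad_coord[OF c]])
qed

lemma has_grad_progress:
  "has_grad d (progress m) (\<lambda>j. if j \<in> blk m then al j * ramp' (x j / al j) else 0) x"
proof -
  have "has_grad d (\<lambda>y. \<Sum>c\<in>blk m. (al c)\<^sup>2 * ramp (y c / al c))
      (\<lambda>j. \<Sum>c\<in>blk m. al c * ramp' (x c / al c) * (if j = c then 1 else 0)) x"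
    by (intro has_grad_sum finite_blk has_grad_sep DERIV_ramp) (simp add: blk_def)
  moreover have "(\<Sum>c\<in>blk m. al c * ramp' (x c / al c) * (if j = c then 1 else 0))
      = (if j \<in> blk m then al j * ramp' (x j / al j) else 0)" for j
    by (simp add: finite_blk if_distrib[where f="\<lambda>u. _ * u"] cong: if_cong)
  ultimately show ?thesis by (simp add: progress_def[abs_def])
qed

lemma has_grad_gate:
  "has_grad d (gate m) (\<lambda>j. gate' m x * (if j \<in> blk m then al j * ramp' (x j / al j) else 0)) x"
proof (cases "m = 0")
  case True
  then show ?thesis using has_grad_const[of d 1 x] by (simp add: gate_def[abs_def] gate'_def)
next
  case False
  have "((\<lambda>z. 2 * z - 1 / 2) has_real_derivative 2) (at (progress m x))"
    by (auto intro!: derivative_eq_intros)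
  from DERIV_chain2[OF DERIV_ramp this]
  have "((\<lambda>z. ramp (2 * z - 1 / 2)) has_real_derivative gate' m x) (at (progress m x))"
    using False by (simp add: gate'_def mult.commute)
  from has_grad_compose[OF has_grad_progress this] show ?thesis
    using False by (simp add: gate_def[abs_def])
qed

lemma has_grad_obj:
  assumes I: "I \<subseteq> {..<d}"
  shows "has_grad d (obj I) (gobj I x) x"
proof -
  have fin: "finite I" using I finite_subset by blast
  let ?y = "\<lambda>c. x c / al c"
  let ?g = "\<lambda>m j. gate' m x * (if j \<in> blk m then al j * ramp' (?y j) else 0)"
  let ?G = "\<lambda>c j. al c * min (?y c) 0 * (if j = c then 1 else 0)
      - (gate (st c - 1) x * (al c * climb' (?y c) * (if j = c then 1 else 0))
         + (al c)\<^sup>2 * climb (?y c) * ?g (st c - 1) j)"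
  have "has_grad d (\<lambda>y. \<Sum>c\<in>I. (al c)\<^sup>2 * wall (y c / al c)
          - gate (st c - 1) y * ((al c)\<^sup>2 * climb (y c / al c))) (\<lambda>j. \<Sum>c\<in>I. ?G c j) x"
    using I by (intro has_grad_sum fin has_grad_diff has_grad_mult has_grad_gate has_grad_sep
        DERIV_wall DERIV_climb) auto
  moreover have "(\<lambda>y. \<Sum>c\<in>I. (al c)\<^sup>2 * wall (y c / al c)
          - gate (st c - 1) y * ((al c)\<^sup>2 * climb (y c / al c))) = obj I"
    by (simp add: obj_def[abs_def] algebra_simps)
  moreover have "(\<Sum>c\<in>I. ?G c j) = gobj I x j" for j
  proof (cases "j < d")
    case False
    then have "j \<notin> blk m" for m by (simp add: blk_def)
    moreover have "c \<in> I \<Longrightarrow> j \<noteq> c" for c using I False by auto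
    ultimately show ?thesis using False by (simp add: gobj_def sum.neutral)
  next
    case True
    have 1: "(\<Sum>c\<in>I. al c * min (?y c) 0 * (if j = c then 1 else 0))
        = (if j \<in> I then al j * min (?y j) 0 else 0)"
      by (simp add: fin if_distrib[where f="\<lambda>u. _ * u"] cong: if_cong)
    have 2: "(\<Sum>c\<in>I. gate (st c - 1) x * (al c * climb' (?y c) * (if j = c then 1 else 0)))
        = (if j \<in> I then gate (st j - 1) x * (al j * climb' (?y j)) else 0)"
      by (simp add: fin if_distrib[where f="\<lambda>u. _ * u"] cong: if_cong)
    have "(\<Sum>c\<in>I. (al c)\<^sup>2 * climb (?y c) * ?g (st c - 1) j)
        = (\<Sum>c\<in>I. if c \<in> blk (st j + 1)
             then al j * gate' (st j) x * ramp' (?y j) * ((al c)\<^sup>2 * climb (?y c)) else 0)"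
    proof (rule sum.cong)
      fix c assume "c \<in> I"
      \<comment> \<open>Since stages start at 1, the truncated subtraction in
        \<open>st c - 1\<close> is exact and can be inverted.\<close>
      then have "c < d" "st c \<ge> 1" using I st_range[of c] by auto
      then have "j \<in> blk (st c - 1) \<longleftrightarrow> c \<in> blk (st j + 1)"
        using True by (auto simp: blk_def)
      then show "(al c)\<^sup>2 * climb (?y c) * ?g (st c - 1) j = (if c \<in> blk (st j + 1)
             then al j * gate' (st j) x * ramp' (?y j) * ((al c)\<^sup>2 * climb (?y c)) else 0)"
        by (auto simp: blk_def)
    qed simp
    also have "\<dots> = al j * gate' (st j) x * ramp' (?y j) * reward I (st j + 1) x"
      unfolding reward_def sum_distrib_left sum.inter_restrict[OF fin]
      by (intro sum.cong) simp_all
    finally show ?thesis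
      unfolding sum_subtractf sum.distrib 1 2 using True by (simp add: gobj_def algebra_simps)
  qed
  ultimately show ?thesis by simp
qed

lemma gobj_Rd: "gobj I x \<in> Rd d"
  by (simp add: in_Rd gobj_def)

text \<open>\<open>ramp'\<close> vanishes at 0, which removes the gate term. An untouched coordinate
  is therefore visible only to the worker that holds it, and only if the preceding gate is not
  closed.\<close>

lemma gobj_at_zero:
  assumes "x c = 0"
  shows "gobj I x c = (if c < d \<and> c \<in> I then - (al c * gate (st c - 1) x / 2) else 0)"
  by (simp add: gobj_def assms climb'_0 ramp'_eq_0)

section \<open>Bounds and the Lipschitz constant of the gradient\<close>

lemma blk_weight_le: "(\<Sum>c\<in>blk m. (al c)\<^sup>2) \<le> 1"
proof (cases "m \<in> {1..K}")
  case True
  then show ?thesis using stage_weight by (simp add: blk_def)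
next
  case False
  then have "blk m = {}" using st_range by (force simp: blk_def)
  then show ?thesis by simp
qed

lemma gate_bounds: "0 \<le> gate m x" "gate m x \<le> 1"
  by (simp_all add: gate_def ramp_nonneg ramp_le_1)

lemma gate'_bounds: "0 \<le> gate' m x" "gate' m x \<le> 4"
  using ramp'_nonneg ramp'_le[of "2 * progress m x - 1 / 2"] by (simp_all add: gate'_def)

lemma reward_bounds: "0 \<le> reward I m x" "reward I m x \<le> 1"
proof -
  show "0 \<le> reward I m x"
    by (simp add: reward_def sum_nonneg climb_bounds)
  have "reward I m x \<le> (\<Sum>c\<in>I \<inter> blk m. (al c)\<^sup>2 * 1)"
    unfolding reward_def by (intro sum_mono mult_left_mono) (simp_all add: climb_bounds)
  also have "\<dots> \<le> (\<Sum>c\<in>blk m. (al c)\<^sup>2)"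
    by (simp, intro sum_mono2) (auto simp: finite_blk)
  finally show "reward I m x \<le> 1" using blk_weight_le[of m] by simp
qed

definition blk_dist :: "nat \<Rightarrow> vect \<Rightarrow> vect \<Rightarrow> real" where
  "blk_dist m x z = L2_set (\<lambda>c. x c - z c) (blk m)"

text \<open>The inner scaling consumes one factor \<open>al c\<close>; the other one is absorbed by
  Cauchy-Schwarz, because \<open>al\<close> has norm at most 1 on a stage. The constant is thus
  independent of the number of coordinates.\<close>

lemma sep_lipschitz:
  assumes h: "\<And>y z. \<bar>h y - h z\<bar> \<le> M * \<bar>y - z\<bar>" and I: "I \<subseteq> blk m" and M: "0 \<le> M"
  shows "\<bar>(\<Sum>c\<in>I. (al c)\<^sup>2 * h (x c / al c)) - (\<Sum>c\<in>I. (al c)\<^sup>2 * h (z c / al c))\<bar>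
    \<le> M * blk_dist m x z"
proof -
  have "\<bar>(\<Sum>c\<in>I. (al c)\<^sup>2 * h (x c / al c)) - (\<Sum>c\<in>I. (al c)\<^sup>2 * h (z c / al c))\<bar>
      \<le> (\<Sum>c\<in>I. \<bar>(al c)\<^sup>2 * h (x c / al c) - (al c)\<^sup>2 * h (z c / al c)\<bar>)"
    by (simp add: sum_abs flip: sum_subtractf)
  also have "\<dots> \<le> (\<Sum>c\<in>I. M * (\<bar>al c\<bar> * \<bar>x c - z c\<bar>))"
  proof (rule sum_mono)
    fix c assume "c \<in> I"
    then have a: "al c > 0" using I al_pos by (auto simp: blk_def)
    have q: "\<bar>x c / al c - z c / al c\<bar> = \<bar>x c - z c\<bar> / al c"
      using a by (simp flip: diff_divide_distrib)
    have "\<bar>(al c)\<^sup>2 * h (x c / al c) - (al c)\<^sup>2 * h (z c / al c)\<bar>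
        = (al c)\<^sup>2 * \<bar>h (x c / al c) - h (z c / al c)\<bar>"
      by (simp add: abs_mult flip: right_diff_distrib)
    also have "\<dots> \<le> (al c)\<^sup>2 * (M * \<bar>x c / al c - z c / al c\<bar>)"
      by (intro mult_left_mono h) simp
    also have "\<dots> = M * (\<bar>al c\<bar> * \<bar>x c - z c\<bar>)"
      unfolding q using a by (simp add: power2_eq_square)
    finally show "\<bar>(al c)\<^sup>2 * h (x c / al c) - (al c)\<^sup>2 * h (z c / al c)\<bar>
        \<le> M * (\<bar>al c\<bar> * \<bar>x c - z c\<bar>)" .
  qed
  also have "\<dots> \<le> M * (\<Sum>c\<in>blk m. \<bar>al c\<bar> * \<bar>x c - z c\<bar>)"
    unfolding sum_distrib_left[symmetric]
    by (intro mult_left_mono sum_mono2 M I) (auto simp: finite_blk)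
  also have "\<dots> \<le> M * (L2_set al (blk m) * blk_dist m x z)"
    unfolding blk_dist_def by (intro mult_left_mono L2_set_mult_ineq M)
  also have "\<dots> \<le> M * (1 * blk_dist m x z)"
    using blk_weight_le[of m] M
    by (intro mult_left_mono mult_right_mono) (auto simp: L2_set_def blk_dist_def sum_nonneg)
  finally show ?thesis by simp
qed

lemma blk_dist_nonneg: "0 \<le> blk_dist m x z"
  by (simp add: blk_dist_def)

lemma progress_lipschitz: "\<bar>progress m x - progress m z\<bar> \<le> 2 * blk_dist m x z"
  unfolding progress_def by (rule sep_lipschitz) (auto simp: ramp_lipschitz)

lemma reward_lipschitz: "\<bar>reward I m x - reward I m z\<bar> \<le> 1 / 2 * blk_dist m x z"
  unfolding reward_def by (rule sep_lipschitz) (use climb_lipschitz in auto)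

lemma abs_double_diff: "\<bar>2 * a - 2 * b\<bar> = 2 * \<bar>a - b\<bar>" for a b :: real
  by (simp add: abs_if)

lemma gate_lipschitz: "\<bar>gate m x - gate m z\<bar> \<le> 8 * blk_dist m x z"
  using progress_lipschitz[of m x z] blk_dist_nonneg[of m x z]
    ramp_lipschitz[of "2 * progress m x - 1 / 2" "2 * progress m z - 1 / 2"]
  by (auto simp: gate_def abs_double_diff)

lemma gate'_lipschitz: "\<bar>gate' m x - gate' m z\<bar> \<le> 32 * blk_dist m x z"
  using progress_lipschitz[of m x z] blk_dist_nonneg[of m x z]
    ramp'_lipschitz[of "2 * progress m x - 1 / 2" "2 * progress m z - 1 / 2"]
  by (auto simp: gate'_def abs_double_diff)

text \<open>The coordinate involves the gate before its stage, the gate of its stage and the reward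
  of the next one, hence the three distances. The largest coefficient is \<open>2 * 32\<close> at
  the distance within its own stage; 64 dominates all of them.\<close>

lemma gobj_coord_lipschitz:
  assumes c: "c < d"
  shows "\<bar>gobj {..<d} x c - gobj {..<d} z c\<bar> \<le> 64 * (\<bar>x c - z c\<bar>
    + al c * (blk_dist (st c - 1) x z + blk_dist (st c) x z + blk_dist (st c + 1) x z))"
proof -
  define m where "m = st c"
  define u where "u = x c / al c"
  define w where "w = z c / al c"
  define e where "e = \<bar>u - w\<bar>"
  define d0 where "d0 = blk_dist (m - 1) x z"
  let ?d1 = "blk_dist m x z" and ?d2 = "blk_dist (m + 1) x z"
  let ?R = "reward {..<d} (m + 1)"
  have a: "al c > 0" using al_pos[OF c] .
  have e: "al c * e = \<bar>x c - z c\<bar>"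
    using a by (simp add: e_def u_def w_def flip: diff_divide_distrib)
  have nn: "0 \<le> e" "0 \<le> d0" "0 \<le> ?d1" "0 \<le> ?d2"
    by (auto simp: e_def d0_def blk_dist_nonneg)
  have 1: "\<bar>min u 0 - min w 0\<bar> \<le> e"
    by (auto simp: e_def min_def)
  have 2: "\<bar>gate (m - 1) x * climb' u - gate (m - 1) z * climb' w\<bar> \<le> 1 * (e / 4) + 1 / 2 * (8 * d0)"
    by (rule abs_mult_diff_le)
       (use climb'_bounds[of w] climb'_lipschitz[of u w] gate_bounds[of "m - 1" x] gate_lipschitz
         in \<open>auto simp: e_def d0_def\<close>)
  have 3: "\<bar>gate' m x * ramp' u - gate' m z * ramp' w\<bar> \<le> 4 * (4 * e) + 2 * (32 * ?d1)"
    by (rule abs_mult_diff_le)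
       (use ramp'_nonneg[of w] ramp'_le[of w] ramp'_lipschitz[of u w] gate'_bounds[of m x]
         gate'_lipschitz in \<open>auto simp: e_def\<close>)
  have "\<bar>gate' m x * ramp' u\<bar> \<le> 4 * 2"
    using gate'_bounds[of m x] ramp'_nonneg[of u] ramp'_le[of u]
    unfolding abs_mult by (intro mult_mono) auto
  then have 4: "\<bar>gate' m x * ramp' u * ?R x - gate' m z * ramp' w * ?R z\<bar>
      \<le> 4 * 2 * (1 / 2 * ?d2) + 1 * (4 * (4 * e) + 2 * (32 * ?d1))"
    using 3 by (intro abs_mult_diff_le[where b="?R x"] reward_lipschitz)
      (use reward_bounds[of "{..<d}" "m + 1" z] in auto)
  have eq: "gobj {..<d} x c - gobj {..<d} z c = al c * ((min u 0 - min w 0)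
      - (gate (m - 1) x * climb' u - gate (m - 1) z * climb' w)
      - (gate' m x * ramp' u * ?R x - gate' m z * ramp' w * ?R z))"
    using c by (simp add: gobj_def m_def u_def w_def algebra_simps)
  have tri: "\<bar>p\<bar> + \<bar>q\<bar> + \<bar>r\<bar> \<le> b \<Longrightarrow> \<bar>p - q - r\<bar> \<le> b" for p q r b :: real
    by linarith
  have "e + (1 * (e / 4) + 1 / 2 * (8 * a0)) + (4 * 2 * (1 / 2 * a2) + 1 * (4 * (4 * e) + 2 * (32 * a1)))
      \<le> 64 * (e + (a0 + a1 + a2))" if "0 \<le> e" "0 \<le> a0" "0 \<le> a1" "0 \<le> a2" for e a0 a1 a2 :: real
    using that by (simp add: algebra_simps)
  note le = tri[OF order_trans[OF add_mono[OF add_mono[OF 1 2] 4] this[OF nn]]]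
  have "\<bar>gobj {..<d} x c - gobj {..<d} z c\<bar> \<le> al c * (64 * (e + (d0 + ?d1 + ?d2)))"
    unfolding eq abs_mult abs_of_pos[OF a] by (rule mult_left_mono[OF le]) (use a in simp)
  then show ?thesis
    unfolding e[symmetric] m_def[symmetric] d0_def[symmetric]
    by (simp only: mult.left_commute[of "al c" 64] distrib_left)
qed

lemma sum_by_stage: "(\<Sum>c<d. h c) = (\<Sum>m\<in>{1..K}. \<Sum>c\<in>blk m. h c)"
proof -
  have "st ` {..<d} \<subseteq> {1..K}" using st_range by blast
  from sum.group[OF _ _ this, of h] show ?thesis by (simp add: blk_def)
qed

text \<open>The weights in each stage sum to 1, so every stage contributes one block distance; an
  injective change of the stage index keeps these blocks disjoint. It is meant for the shifts by -1,
  0 and 1.\<close>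

lemma sum_blk_dist_le:
  assumes "inj_on f {1..K}"
  shows "(\<Sum>c<d. (al c)\<^sup>2 * (blk_dist (f (st c)) x z)\<^sup>2) \<le> (vnorm d (x - z))\<^sup>2"
proof -
  have "(\<Sum>c<d. (al c)\<^sup>2 * (blk_dist (f (st c)) x z)\<^sup>2)
      = (\<Sum>m\<in>{1..K}. (\<Sum>c\<in>blk m. (al c)\<^sup>2) * (blk_dist (f m) x z)\<^sup>2)"
    unfolding sum_by_stage sum_distrib_right by (intro sum.cong) (auto simp: blk_def)
  also have "\<dots> = (\<Sum>m\<in>{1..K}. (blk_dist (f m) x z)\<^sup>2)"
    using stage_weight by (intro sum.cong) (auto simp: blk_def)
  also have "\<dots> = (\<Sum>m\<in>f ` {1..K}. (blk_dist m x z)\<^sup>2)"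
    using assms by (simp add: sum.reindex)
  also have "\<dots> = (\<Sum>m\<in>f ` {1..K}. \<Sum>c\<in>blk m. (x c - z c)\<^sup>2)"
    by (simp add: blk_dist_def L2_set_def sum_nonneg)
  also have "\<dots> = (\<Sum>c\<in>(\<Union>m\<in>f ` {1..K}. blk m). (x c - z c)\<^sup>2)"
    by (rule sum.UNION_disjoint[symmetric]) (auto simp: finite_blk, auto simp: blk_def)
  also have "\<dots> \<le> (\<Sum>c<d. (x c - z c)\<^sup>2)"
    by (rule sum_mono2) (auto simp: blk_def)
  finally show ?thesis by (simp add: vnorm_sq)
qed

text \<open>Squaring the coordinatewise bound gives four sums, each at most
  \<open>(vnorm d (x - z))^2\<close>, and \<open>64^2 * 4 * 4 = 256^2\<close>. Neither
  \<open>K\<close> nor \<open>d\<close> enters.\<close>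

lemma gobj_lipschitz:
  "vnorm d (gobj {..<d} x - gobj {..<d} z) \<le> 256 * vnorm d (x - z)"
proof (rule power2_le_imp_le)
  have sq4: "(a + b * (p + q + r))\<^sup>2 \<le> 4 * (a\<^sup>2 + (b\<^sup>2 * p\<^sup>2 + b\<^sup>2 * q\<^sup>2 + b\<^sup>2 * r\<^sup>2))"
    for a b p q r :: real
  proof -
    have "(a + (s + t + u))\<^sup>2 \<le> 4 * (a\<^sup>2 + (s\<^sup>2 + t\<^sup>2 + u\<^sup>2))" for s t u :: real
    proof -
      have "4 * (a\<^sup>2 + (s\<^sup>2 + t\<^sup>2 + u\<^sup>2)) - (a + (s + t + u))\<^sup>2 =
          (a - s)\<^sup>2 + (a - t)\<^sup>2 + (a - u)\<^sup>2 + (s - t)\<^sup>2 + (s - u)\<^sup>2 + (t - u)\<^sup>2"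
        by algebra
      then show ?thesis by (smt (verit) zero_le_power2)
    qed
    from this[of "b * p" "b * q" "b * r"] show ?thesis
      by (simp add: power_mult_distrib distrib_left)
  qed
  have "(vnorm d (gobj {..<d} x - gobj {..<d} z))\<^sup>2 \<le> (\<Sum>c<d. (64 * (\<bar>x c - z c\<bar>
    + al c * (blk_dist (st c - 1) x z + blk_dist (st c) x z + blk_dist (st c + 1) x z)))\<^sup>2)"
    unfolding vnorm_sq
  proof (rule sum_mono)
    fix c assume "c \<in> {..<d}"
    then have "\<bar>(gobj {..<d} x - gobj {..<d} z) c\<bar> \<le> \<bar>64 * (\<bar>x c - z c\<bar>
        + al c * (blk_dist (st c - 1) x z + blk_dist (st c) x z + blk_dist (st c + 1) x z))\<bar>"
      using order_trans[OF gobj_coord_lipschitz abs_ge_self] by simp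
    then show "((gobj {..<d} x - gobj {..<d} z) c)\<^sup>2 \<le> (64 * (\<bar>x c - z c\<bar>
        + al c * (blk_dist (st c - 1) x z + blk_dist (st c) x z + blk_dist (st c + 1) x z)))\<^sup>2"
      by (simp only: abs_le_square_iff)
  qed
  also have "\<dots> = 4096 * (\<Sum>c<d. (\<bar>x c - z c\<bar>
    + al c * (blk_dist (st c - 1) x z + blk_dist (st c) x z + blk_dist (st c + 1) x z))\<^sup>2)"
    unfolding power_mult_distrib sum_distrib_left[symmetric] by simp
  also have "\<dots> \<le> 4096 * (\<Sum>c<d. 4 * (\<bar>x c - z c\<bar>\<^sup>2 + ((al c)\<^sup>2 * (blk_dist (st c - 1) x z)\<^sup>2
      + (al c)\<^sup>2 * (blk_dist (st c) x z)\<^sup>2 + (al c)\<^sup>2 * (blk_dist (st c + 1) x z)\<^sup>2)))"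
    by (intro mult_left_mono sum_mono sq4) simp
  also have "\<dots> = 16384 * ((vnorm d (x - z))\<^sup>2 + ((\<Sum>c<d. (al c)\<^sup>2 * (blk_dist (st c - 1) x z)\<^sup>2)
      + (\<Sum>c<d. (al c)\<^sup>2 * (blk_dist (st c) x z)\<^sup>2) + (\<Sum>c<d. (al c)\<^sup>2 * (blk_dist (st c + 1) x z)\<^sup>2)))"
    unfolding vnorm_sq sum_distrib_left[symmetric] sum.distrib by simp
  also have "\<dots> \<le> 16384 * ((vnorm d (x - z))\<^sup>2 +
      ((vnorm d (x - z))\<^sup>2 + (vnorm d (x - z))\<^sup>2 + (vnorm d (x - z))\<^sup>2))"
  proof -
    have "inj_on (\<lambda>m::nat. m - 1) {1..K}" "inj_on (\<lambda>m::nat. m) {1..K}"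
      "inj_on (\<lambda>m::nat. m + 1) {1..K}"
      by (auto simp: inj_on_def)
    note le = this[THEN sum_blk_dist_le, of x z]
    show ?thesis
      by (intro mult_left_mono add_mono order_refl) (use le in simp_all)
  qed
  also have "\<dots> = (256 * vnorm d (x - z))\<^sup>2" by (simp add: power_mult_distrib)
  finally show "(vnorm d (gobj {..<d} x - gobj {..<d} z))\<^sup>2 \<le> (256 * vnorm d (x - z))\<^sup>2" .
qed (simp add: vnorm_nonneg)

lemma obj_ge: "- real K \<le> obj {..<d} x"
proof -
  have "- real K = (\<Sum>c<d. - (al c)\<^sup>2)"
    unfolding sum_by_stage using stage_weight by (simp add: sum_negf blk_def)
  also have "\<dots> \<le> obj {..<d} x"
    unfolding obj_def
  proof (rule sum_mono)
    fix c
    have "gate (st c - 1) x * climb (x c / al c) \<le> 1 * 1"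
      by (intro mult_mono gate_bounds climb_bounds) auto
    moreover have "0 \<le> wall (x c / al c)" by (simp add: wall_def)
    ultimately have "(al c)\<^sup>2 * (-1) \<le> (al c)\<^sup>2 *
        (wall (x c / al c) - gate (st c - 1) x * climb (x c / al c))"
      by (intro mult_left_mono) auto
    then show "- (al c)\<^sup>2 \<le> (al c)\<^sup>2 *
        (wall (x c / al c) - gate (st c - 1) x * climb (x c / al c))"
      by simp
  qed
  finally show ?thesis .
qed

lemma obj_0: "obj I (\<lambda>_. 0) \<le> 0"
  unfolding obj_def
  by (intro sum_nonpos mult_nonneg_nonpos) (auto simp: wall_def gate_bounds climb_bounds)

text \<open>
  At the first gate that is not fully open, all three contributions to the
  derivative in a coordinate that has not been climbed have the same sign.
\<close>

lemma gobj_large: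
  assumes K: "gate K x \<noteq> 1"
  shows "1 / 64 \<le> (vnorm d (gobj {..<d} x))\<^sup>2"
proof -
  define m where "m = (LEAST m. gate m x \<noteq> 1)"
  have m: "gate m x \<noteq> 1" "m \<le> K"
    unfolding m_def using LeastI[of "\<lambda>m. gate m x \<noteq> 1" K] Least_le[of "\<lambda>m. gate m x \<noteq> 1" K] K
    by auto
  from m(1) have m0: "m \<noteq> 0" by (intro notI) (simp add: gate_def)
  have prev: "gate (m - 1) x = 1"
    using not_less_Least[of "m - 1" "\<lambda>m. gate m x \<noteq> 1"] m0 unfolding m_def by auto
  \<comment> \<open>The gate is fully open as soon as \<open>2 * progress m x - 1 / 2\<close>
    reaches 1.\<close>
  have P: "progress m x < 3 / 4"
    using m m0 ramp_eq_1[of "2 * progress m x - 1 / 2"] by (force simp: gate_def)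
  \<comment> \<open>The unclimbed part of the stage distributes the bound over the coordinates:
    those with \<open>y \<ge> 1\<close> count 0, and all others have a derivative of size at least
    \<open>al c / 4\<close>.\<close>
  have "1 / 64 \<le> (1 - progress m x) / 16" using P by simp
  also have "\<dots> = (\<Sum>c\<in>blk m. (al c)\<^sup>2 * (1 - ramp (x c / al c)) / 16)"
    using stage_weight[of m] m m0
    by (simp add: progress_def blk_def right_diff_distrib sum_subtractf flip: sum_divide_distrib)
  also have "\<dots> \<le> (\<Sum>c\<in>blk m. (gobj {..<d} x c)\<^sup>2)"
  proof (rule sum_mono)
    fix c assume "c \<in> blk m"
    then have c: "c < d" "st c = m" by (auto simp: blk_def)
    note a = al_pos[OF c(1)]
    define y where "y = x c / al c"
    show "(al c)\<^sup>2 * (1 - ramp (x c / al c)) / 16 \<le> (gobj {..<d} x c)\<^sup>2"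
    proof (cases "y < 1")
      case True
      have "0 \<le> gate' m x * ramp' y * reward {..<d} (m + 1) x"
        by (intro mult_nonneg_nonneg gate'_bounds ramp'_nonneg reward_bounds)
      \<comment> \<open>Between -1 and 1 the slope of \<open>climb\<close> supplies 1/4; further
        left the wall alone supplies more than 1.\<close>
      moreover have "min y 0 - climb' y \<le> - 1 / 4"
      proof (cases "y \<ge> -1")
        case ge: True
        then show ?thesis using climb'_ge[of y] True by (simp add: min_def abs_le_iff)
      next
        case False
        then show ?thesis using climb'_bounds(1)[of y] by (simp add: min_def)
      qed
      ultimately have "1 / 4 \<le> - (min y 0 - climb' y - gate' m x * ramp' y * reward {..<d} (m + 1) x)"
        by simp
      then have "al c * (1 / 4) \<le> al c *
          - (min y 0 - climb' y - gate' m x * ramp' y * reward {..<d} (m + 1) x)"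
        using a by (intro mult_left_mono) auto
      also have "\<dots> = - gobj {..<d} x c"
        unfolding gobj_def y_def c(2) prev mult_minus_right using c(1) by simp
      finally have "al c * (1 / 4) \<le> - gobj {..<d} x c" .
      then have "(al c * (1 / 4))\<^sup>2 \<le> (- gobj {..<d} x c)\<^sup>2"
        using a by (intro power_mono) simp_all
      moreover have "(al c)\<^sup>2 * (1 - ramp (x c / al c)) \<le> (al c)\<^sup>2 * 1"
        by (intro mult_left_mono) (auto simp: ramp_nonneg)
      ultimately show ?thesis by (simp add: power_mult_distrib power2_eq_square)
    next
      case False
      then show ?thesis by (simp add: y_def ramp_eq_1)
    qed
  qed
  also have "\<dots> \<le> (vnorm d (gobj {..<d} x))\<^sup>2"
    unfolding vnorm_sq by (rule sum_mono2) (auto simp: blk_def)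
  finally show ?thesis .
qed

text \<open>Coordinates at 0 add nothing to the progress, and any other adds at most its weight;
  \<open>2 * (1 / 4) - 1 / 2 = 0\<close> is where the gate starts to open.\<close>

lemma gate_closed:
  assumes "m \<noteq> 0" and "(\<Sum>c\<in>blk m \<inter> {c. x c \<noteq> 0}. (al c)\<^sup>2) \<le> 1 / 4"
  shows "gate m x = 0"
proof -
  have "progress m x = (\<Sum>c\<in>blk m \<inter> {c. x c \<noteq> 0}. (al c)\<^sup>2 * ramp (x c / al c))"
    unfolding progress_def by (rule sum.mono_neutral_right) (auto simp: finite_blk ramp_eq_0)
  also have "\<dots> \<le> (\<Sum>c\<in>blk m \<inter> {c. x c \<noteq> 0}. (al c)\<^sup>2 * 1)"
    by (intro sum_mono mult_left_mono) (auto simp: ramp_le_1)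
  finally show ?thesis using assms by (simp add: gate_def ramp_eq_0)
qed

end

subsection \<open>Periods and the work available in them\<close>

lemma computation_work_mono:
  assumes v: "computation_power (v i)" and "0 \<le> s" "s \<le> t"
  shows "computation_work v i s \<le> computation_work v i t"
  using assms unfolding computation_work_def computation_power_def
  by (intro integral_subset_le) auto

lemma computation_work_right_continuous:
  assumes v: "computation_power (v i)" and t: "0 \<le> t" and e: "0 < e"
  shows "\<exists>t'>t. computation_work v i t' < computation_work v i t + e"
proof -
  have "v i integrable_on {0..t + 1}"
    using v t by (simp add: computation_power_def)
  then have "continuous_on {0..t + 1} (\<lambda>x. integral {0..x} (v i))"
    by (rule indefinite_integral_continuous_1)
  then obtain \<delta> where \<delta>: "\<delta> > 0" "\<And>x. x \<in> {0..t + 1} \<Longrightarrow> dist x t < \<delta> \<Longrightarrow>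
      dist (integral {0..x} (v i)) (integral {0..t} (v i)) < e"
    using t e unfolding continuous_on_iff by (metis atLeastAtMost_iff less_add_one less_imp_le)
  define x where "x = t + min 1 (\<delta> / 2)"
  have "x \<in> {0..t + 1}" "dist x t < \<delta>" "x > t"
    using \<delta>(1) t by (auto simp: x_def dist_real_def)
  with \<delta>(2)[of x] show ?thesis
    by (intro exI[of _ x]) (auto simp: computation_work_def dist_real_def)
qed

locale work =
  fixes n :: nat and V :: "nat \<Rightarrow> real \<Rightarrow> real" and c2 c3 \<sigma> \<epsilon> :: real
  assumes n: "1 \<le> n"
    and mono: "i \<in> {1..n} \<Longrightarrow> 0 \<le> s \<Longrightarrow> s \<le> t \<Longrightarrow> V i s \<le> V i t"
    and right_cont: "i \<in> {1..n} \<Longrightarrow> 0 \<le> t \<Longrightarrow> 0 < e \<Longrightarrow> \<exists>t'>t. V i t' < V i t + e"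
    and c3: "0 < c3"
begin

definition units :: "real \<Rightarrow> nat \<Rightarrow> real \<Rightarrow> int" where
  "units s i t = \<lfloor>c3 * (V i t - V i s)\<rfloor>"

definition target :: real where
  "target = max (c2 * (\<sigma>\<^sup>2 / (real n * \<epsilon>))) 1"

abbreviation enough :: "real \<Rightarrow> real \<Rightarrow> bool" where
  "enough \<equiv> enough_work n V c2 c3 \<sigma> \<epsilon>"

abbreviation tau :: "nat \<Rightarrow> ereal" where
  "tau \<equiv> t_lower n V c2 c3 \<sigma> \<epsilon>"

lemma units_mono:
  "i \<in> {1..n} \<Longrightarrow> 0 \<le> t \<Longrightarrow> t \<le> t' \<Longrightarrow> units s i t \<le> units s i t'"
  unfolding units_def using mono[of i t t'] c3 by (intro floor_mono mult_left_mono) auto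

lemma units_self: "units s i s = 0"
  by (simp add: units_def)

text \<open>A single infinite reciprocal makes the sum infinite and the harmonic mean 0, which is
  below the required 1.\<close>

lemma not_enough_if_zero:
  assumes "i \<in> {1..n}" "units s i t = 0"
  shows "\<not> enough s t"
proof -
  have "(\<Sum>i\<in>{1..n}. inverse (ereal (real_of_int (units s i t)))) = \<infinity>"
    using assms by (subst sum_Pinfty) force
  then show ?thesis
    using n by (simp add: enough_work_def units_def)
qed

lemma sum_inverse_units:
  assumes "\<And>i. i \<in> {1..n} \<Longrightarrow> units s i t \<noteq> 0"
  shows "ereal (1 / real n) * (\<Sum>i\<in>{1..n}. inverse (ereal (real_of_int (units s i t))))
    = ereal (1 / real n * (\<Sum>i\<in>{1..n}. 1 / real_of_int (units s i t)))"
proof -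
  have "(\<Sum>i\<in>{1..n}. inverse (ereal (real_of_int (units s i t))))
      = (\<Sum>i\<in>{1..n}. ereal (1 / real_of_int (units s i t)))"
    using assms by (intro sum.cong) (auto simp: divide_inverse)
  then show ?thesis by simp
qed

text \<open>The minimum in \<open>t_lower\<close> ranges over all \<open>t \<ge> 0\<close>, also up
  to \<open>s\<close>, where no floor is positive. A floor equal to 0 makes the harmonic mean 0, and
  if all floors are negative it is negative, so the target is missed.\<close>

lemma enough_gt:
  assumes "0 \<le> s" "0 \<le> t" "enough s t"
  shows "s < t"
proof (rule ccontr)
  assume "\<not> s < t"
  then have le: "units s i t \<le> 0" if "i \<in> {1..n}" for i
    using units_mono[of i t s s] that assms by (simp add: units_self)
  then have neg: "units s i t < 0" if "i \<in> {1..n}" for i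
    using not_enough_if_zero[OF that] assms(3) that by (metis order_le_less)
  have "(\<Sum>i\<in>{1..n}. 1 / real_of_int (units s i t)) < 0"
    using sum_pos[of "{1..n}" "\<lambda>i. - (1 / real_of_int (units s i t))"] n neg
    by (simp add: sum_negf)
  then have S: "1 / real n * (\<Sum>i\<in>{1..n}. 1 / real_of_int (units s i t)) < 0"
    using n by (simp add: mult_less_0_iff divide_less_0_iff)
  have "ereal target \<le> inverse (ereal (1 / real n * (\<Sum>i\<in>{1..n}. 1 / real_of_int (units s i t))))"
    using assms(3) sum_inverse_units[of s t] neg
    unfolding enough_work_def units_def[symmetric] target_def by fastforce
  moreover have "y \<le> inverse x" if "ereal y \<le> inverse (ereal x)" "x < 0" for x y
    using that by simp
  ultimately have "target \<le> inverse (1 / real n * (\<Sum>i\<in>{1..n}. 1 / real_of_int (units s i t)))"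
    using S by blast
  moreover have "1 \<le> target" by (simp add: target_def)
  ultimately show False using S by (smt (verit) inverse_nonpositive_iff_nonpositive)
qed

lemma enough_iff:
  assumes "0 \<le> s" "s \<le> t"
  shows "enough s t \<longleftrightarrow> (\<forall>i\<in>{1..n}. 1 \<le> units s i t) \<and>
    (\<Sum>i\<in>{1..n}. 1 / real_of_int (units s i t)) * target \<le> real n"
proof (cases "\<forall>i\<in>{1..n}. 1 \<le> units s i t")
  case False
  then obtain i where i: "i \<in> {1..n}" "units s i t < 1" by force
  with units_mono[of i s t s] assms have "units s i t = 0" by (simp add: units_self)
  with False not_enough_if_zero[OF i(1)] show ?thesis by blast
next
  case True
  let ?S = "\<Sum>i\<in>{1..n}. 1 / real_of_int (units s i t)"
  have S: "0 < ?S" using n True by (intro sum_pos) force+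
  have "enough s t \<longleftrightarrow> ereal target \<le> inverse (ereal (1 / real n * ?S))"
    using sum_inverse_units[of s t] True
    unfolding enough_work_def units_def[symmetric] target_def by fastforce
  also have "\<dots> \<longleftrightarrow> target \<le> real n / ?S"
    using S n by (simp add: field_simps)
  also have "\<dots> \<longleftrightarrow> ?S * target \<le> real n"
    using S by (simp add: field_simps)
  finally show ?thesis using True by simp
qed

lemma target_ge_1: "1 \<le> target"
  by (simp add: target_def)

lemma enough_mono:
  assumes s: "0 \<le> s" and e: "enough s t" and t: "0 \<le> t" "t \<le> t'"
  shows "enough s t'"
proof -
  have st: "s < t" using enough_gt[OF s t(1) e] .
  have 1: "1 \<le> units s i t" "units s i t \<le> units s i t'" if "i \<in> {1..n}" for i
    using e enough_iff[of s t] st s that units_mono[OF that t] by auto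
  have "(\<Sum>i\<in>{1..n}. 1 / real_of_int (units s i t')) \<le> (\<Sum>i\<in>{1..n}. 1 / real_of_int (units s i t))"
    using 1 by (intro sum_mono divide_left_mono) force+
  then have "(\<Sum>i\<in>{1..n}. 1 / real_of_int (units s i t')) * target
      \<le> (\<Sum>i\<in>{1..n}. 1 / real_of_int (units s i t)) * target"
    using target_ge_1 by (intro mult_right_mono) auto
  also have "\<dots> \<le> real n" using e enough_iff[of s t] st s by auto
  finally show ?thesis
    using enough_iff[of s t'] st s t 1 by force
qed

text \<open>By right-continuity the scaled work stays below the next integer for a short while, so
  its floor does not change; among finitely many workers the shortest such interval serves for
  all.\<close>

lemma not_enough_right:
  assumes s: "0 \<le> s" "s \<le> t" and e: "\<not> enough s t"
  shows "\<exists>t'>t. \<not> enough s t'"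
proof -
  have "\<exists>t'>t. units s i t' = units s i t" if i: "i \<in> {1..n}" for i
  proof -
    let ?r = "c3 * (V i t - V i s)"
    have "0 < (real_of_int \<lfloor>?r\<rfloor> + 1 - ?r) / c3"
      using c3 by (intro divide_pos_pos) (linarith, simp)
    then obtain t' where t': "t' > t" "V i t' < V i t + (real_of_int \<lfloor>?r\<rfloor> + 1 - ?r) / c3"
      using right_cont[OF i, of t] s by force
    then have "c3 * V i t' < c3 * V i t + (real_of_int \<lfloor>?r\<rfloor> + 1 - ?r)"
      using c3 by (simp add: field_simps)
    then have "c3 * (V i t' - V i s) < real_of_int \<lfloor>?r\<rfloor> + 1"
      by (simp add: algebra_simps)
    then have "units s i t' \<le> units s i t" by (simp add: units_def floor_le_iff)
    with units_mono[OF i, of t t' s] t' s show ?thesis by force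
  qed
  then obtain T where T: "\<And>i. i \<in> {1..n} \<Longrightarrow> T i > t \<and> units s i (T i) = units s i t"
    by metis
  define t' where "t' = Min (T ` {1..n})"
  have t': "t' > t" "\<And>i. i \<in> {1..n} \<Longrightarrow> t' \<le> T i"
    using T n by (auto simp: t'_def)
  have eq: "units s i t' = units s i t" if i: "i \<in> {1..n}" for i
    using units_mono[OF i, of t t' s] units_mono[OF i, of t' "T i" s] T[OF i] t' i s by force
  have "enough s t' \<longleftrightarrow> enough s t"
    using eq s t' by (simp add: enough_iff)
  with e t' show ?thesis by blast
qed

text \<open>The set of times with enough work is upward closed by \<open>enough_mono\<close>, and
  \<open>not_enough_right\<close> shows that its infimum belongs to it. Hence \<open>LEAST\<close>
  denotes an attained minimum, which lies after \<open>s\<close> by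
  \<open>enough_gt\<close>.\<close>

lemma tau_step:
  assumes s: "tau j = ereal s" "0 \<le> s"
  shows "ereal s < tau (Suc j)"
    and "s \<le> t \<Longrightarrow> ereal t < tau (Suc j) \<Longrightarrow> \<not> enough s t"
proof -
  define Q where "Q = {t. 0 \<le> t \<and> enough s t}"
  have "ereal s < tau (Suc j) \<and> (\<forall>t\<ge>s. ereal t < tau (Suc j) \<longrightarrow> \<not> enough s t)"
  proof (cases "Q = {}")
    case True
    then show ?thesis using s by (auto simp: Q_def)
  next
    case False
    have gt: "s < t" if "t \<in> Q" for t
      using that enough_gt[OF s(2)] by (auto simp: Q_def)
    then have bdd: "bdd_below Q" by (meson bdd_below.I less_imp_le)
    have "Inf Q \<in> Q"
    proof (rule ccontr)
      assume nQ: "Inf Q \<notin> Q"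
      have "s \<le> Inf Q" using False gt by (intro cInf_greatest) (auto simp: less_imp_le)
      with nQ s obtain t' where t': "Inf Q < t'" "\<not> enough s t'"
        using not_enough_right[of s "Inf Q"] by (auto simp: Q_def)
      then obtain q where "q \<in> Q" "q < t'" using False bdd cInf_less_iff by blast
      with t' enough_mono[OF s(2), of q t'] show False by (auto simp: Q_def)
    qed
    moreover from this have "(LEAST t. 0 \<le> t \<and> enough s t) = Inf Q"
      by (intro Least_equality) (auto simp: Q_def intro!: cInf_lower bdd[unfolded Q_def])
    moreover have "tau (Suc j) = ereal (LEAST t. 0 \<le> t \<and> enough s t)"
      using False s by (auto simp: Q_def)
    ultimately show ?thesis
      using gt s(2) bdd cInf_lower[OF _ bdd] by (auto simp: Q_def not_le[symmetric])
  qed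
  then show "ereal s < tau (Suc j)"
    "s \<le> t \<Longrightarrow> ereal t < tau (Suc j) \<Longrightarrow> \<not> enough s t" by blast+
qed

lemma tau_nonneg: "0 \<le> tau j"
proof (induction j)
  case (Suc j)
  show ?case
  proof (cases "tau j")
    case (real s)
    then have "ereal s < tau (Suc j)" "0 \<le> ereal s" using tau_step(1)[of j s] Suc by auto
    then show ?thesis by (meson less_imp_le order_trans)
  qed (use Suc in auto)
qed simp

lemma tau_less: "tau j = ereal s \<Longrightarrow> tau j < tau (Suc j)"
  using tau_step(1)[of j s] tau_nonneg[of j] by simp

lemma tau_mono: "j \<le> k \<Longrightarrow> tau j \<le> tau k"
proof (rule lift_Suc_mono_le[of tau])
  show "tau j \<le> tau (Suc j)" for j
    using tau_less[of j] tau_nonneg[of j] by (cases "tau j") auto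
qed

text \<open>Whole units of \<open>V\<close> since period \<open>m\<close> began, without the factor
  \<open>c3\<close> used in \<open>units\<close>, because the oracle demands one unit of
  \<open>V\<close> per answer. The value is 0 before the period and if it never begins.\<close>

definition jobs :: "nat \<Rightarrow> nat \<Rightarrow> real \<Rightarrow> nat" where
  "jobs m i t = (case tau (m - 1) of ereal s \<Rightarrow> if s \<le> t then nat \<lfloor>V i t - V i s\<rfloor> else 0 | _ \<Rightarrow> 0)"

lemma jobs_mono:
  assumes "i \<in> {1..n}" "0 \<le> t" "t \<le> t'"
  shows "jobs m i t \<le> jobs m i t'"
  using mono[OF assms] assms by (auto simp: jobs_def split: ereal.split intro!: nat_mono floor_mono)

text \<open>A floor rises by at least 1 when its argument does. This is how a completed job that
  started within the period pays for one more revealed coordinate.\<close>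

lemma jobs_Suc_le:
  assumes i: "i \<in> {1..n}" and st: "0 \<le> st" "st \<le> t" "tau (m - 1) \<le> ereal st"
    and V: "1 \<le> V i t - V i st"
  shows "Suc (jobs m i st) \<le> jobs m i t"
proof -
  obtain s where s: "tau (m - 1) = ereal s" "0 \<le> s"
    using st tau_nonneg[of "m - 1"] by (cases "tau (m - 1)") auto
  have "V i s \<le> V i st" using mono[OF i s(2)] st s by simp
  moreover have "\<lfloor>V i st - V i s\<rfloor> + 1 \<le> \<lfloor>V i t - V i s\<rfloor>"
    unfolding le_floor_iff of_int_add of_int_1 using V of_int_floor_le[of "V i st - V i s"]
    by linarith
  moreover have "Suc (nat a) \<le> nat b" if "0 \<le> a" "a + 1 \<le> b" for a b :: int
    using that by linarith
  ultimately show ?thesis using st s by (simp add: jobs_def)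
qed


text \<open>
  The weights are inversely proportional to the work that the workers can do in the period,
  so that the harmonic mean of that work decides how much of the stage they can reveal.
\<close>

lemma weights_exist:
  assumes c: "c2 = 1" "c3 = 128" and \<epsilon>: "0 < \<epsilon>" and m: "1 \<le> m"
  shows "\<exists>(w :: nat \<Rightarrow> real) (B :: nat \<Rightarrow> nat). (\<forall>i. 0 \<le> w i) \<and> (\<Sum>i\<in>{1..n}. w i) = 1 \<and> (\<forall>i. 1 \<le> B i) \<and>
    (\<forall>i\<in>{1..n}. 32 * (real n)\<^sup>2 * \<epsilon> * w i * (real (B i) - 1) \<le> \<sigma>\<^sup>2) \<and>
    (\<forall>t. 0 \<le> t \<longrightarrow> ereal t < tau m \<longrightarrow> (\<Sum>i\<in>{1..n}. w i * real (jobs m i t) / real (B i)) \<le> 1 / 4)"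
proof -
  \<comment> \<open>If some worker cannot complete a unit during the period, it receives the whole
    stage as one coordinate, shown without noise.\<close>
  have single: ?thesis if k: "k \<in> {1..n}" and J: "\<And>t. 0 \<le> t \<Longrightarrow> ereal t < tau m \<Longrightarrow> jobs m k t = 0" for k
  proof (intro exI conjI)
    let ?w = "\<lambda>i. if i = k then 1 else 0 :: real"
    show "(\<Sum>i\<in>{1..n}. ?w i) = 1" using k by simp
    show "\<forall>t. 0 \<le> t \<longrightarrow> ereal t < tau m \<longrightarrow> (\<Sum>i\<in>{1..n}. ?w i * real (jobs m i t) / real 1) \<le> 1 / 4"
      using J k by (auto simp: if_distrib[where f="\<lambda>u. u * _"] cong: if_cong)
  qed auto
  obtain j where j: "m = Suc j" using m by (cases m) auto
  show ?thesis
  proof (cases "tau j")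
    case PInf
    then have "jobs m i t = 0" for i t by (simp add: jobs_def j)
    then show ?thesis using n by (intro single[of 1]) auto
  next
    case MInf
    then show ?thesis using tau_nonneg[of j] by simp
  next
    case (real s)
    have s: "0 \<le> s" using tau_nonneg[of j] real by simp
    define H where "H = {t. s \<le> t \<and> ereal t < tau m}"
    have sH: "s \<in> H" using tau_step(1)[OF real s] by (simp add: H_def j)
    have H0: "0 \<le> t" "s \<le> t" if "t \<in> H" for t using that s by (auto simp: H_def)
    have nonneg: "0 \<le> units s i t" if "t \<in> H" "i \<in> {1..n}" for t i
      using units_mono[OF that(2) s H0(2)[OF that(1)], of s] by (simp add: units_self)
    have jobs_le: "128 * int (jobs m i t) \<le> units s i t" if "t \<in> H" "i \<in> {1..n}" for t i
    proof -
      have V: "V i s \<le> V i t" using mono[OF that(2) s H0(2)[OF that(1)]] .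
      then have "int (jobs m i t) = \<lfloor>V i t - V i s\<rfloor>"
        using H0[OF that(1)] real by (simp add: jobs_def j)
      moreover have "128 * \<lfloor>V i t - V i s\<rfloor> \<le> \<lfloor>128 * (V i t - V i s)\<rfloor>"
        unfolding le_floor_iff of_int_mult of_int_numeral
        by (intro mult_left_mono of_int_floor_le) simp
      moreover have "units s i t = \<lfloor>128 * (V i t - V i s)\<rfloor>" unfolding units_def unfolding c(2) ..
      ultimately show ?thesis by simp
    qed
    have jobs_early: "jobs m i t = 0" if "t < s" for i t
      using that real by (simp add: jobs_def j)
    have not_enough: "\<not> enough s t" if "t \<in> H" for t
      using tau_step(2)[OF real s] that by (simp add: H_def j)
    show ?thesis
    proof (cases "\<exists>i\<in>{1..n}. \<forall>t\<in>H. units s i t < 1")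
      case True
      then obtain i where i: "i \<in> {1..n}" "\<And>t. t \<in> H \<Longrightarrow> units s i t < 1" by blast
      have "jobs m i t = 0" if t: "0 \<le> t" "ereal t < tau m" for t
      proof (cases "t \<in> H")
        case True
        then show ?thesis using i(2)[OF True] jobs_le[OF True i(1)] by linarith
      qed (use t jobs_early in \<open>auto simp: H_def\<close>)
      then show ?thesis by (rule single[OF i(1)])
    next
      case False
      then obtain T where T: "\<And>i. i \<in> {1..n} \<Longrightarrow> T i \<in> H \<and> 1 \<le> units s i (T i)"
        by (metis linorder_not_less)
      define t0 where "t0 = Max (T ` {1..n})"
      have "t0 \<in> T ` {1..n}" unfolding t0_def using n by (intro Max_in) auto
      then have t0: "t0 \<in> H" using T by auto
      have Tt0: "T i \<le> t0" if "i \<in> {1..n}" for i unfolding t0_def using that by simp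
      \<comment> \<open>From \<open>t0\<close> on all units are positive, so the convention
        \<open>1 / 0 = 0\<close> cannot distort the infimum taken next.\<close>
      define H' where "H' = {t \<in> H. t0 \<le> t}"
      have pos: "1 \<le> units s i t" if "t \<in> H'" "i \<in> {1..n}" for t i
        using T[OF that(2)] units_mono[OF that(2), of "T i" t s] H0[of "T i"] Tt0[OF that(2)] that(1)
        by (force simp: H'_def)
      have big: "real n < (\<Sum>i\<in>{1..n}. 1 / real_of_int (units s i t)) * target" if "t \<in> H'" for t
        using not_enough[of t] enough_iff[OF s, of t] pos[OF that] that H0[of t] by (auto simp: H'_def)
      \<comment> \<open>The reciprocal of the work available in the whole period. In a period that
        never ends the work may be unbounded, and then this is 0.\<close>
      define \<rho> where "\<rho> i = (INF t\<in>H'. 1 / real_of_int (units s i t))" for i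
      have H'_ne: "H' \<noteq> {}" using t0 by (auto simp: H'_def)
      have bdd: "bdd_below ((\<lambda>t. 1 / real_of_int (units s i t)) ` H')" if "i \<in> {1..n}" for i
        using pos[OF _ that] by (intro bdd_belowI2[of _ 0]) force
      have \<rho>: "0 \<le> \<rho> i" "t \<in> H' \<Longrightarrow> \<rho> i \<le> 1 / real_of_int (units s i t)" if "i \<in> {1..n}" for i t
        unfolding \<rho>_def using pos[OF _ that] cINF_lower[OF bdd[OF that]]
        by (auto intro!: cINF_greatest H'_ne) force
      \<comment> \<open>All reciprocals are at most 1 at \<open>t0\<close>, yet the work is not
        enough. This forces \<open>target > 1\<close>, so the maximum is the noise term and \<sigma>
        is not 0.\<close>
      have "(\<Sum>i\<in>{1..n}. 1 / real_of_int (units s i t0)) \<le> (\<Sum>i\<in>{1..n}. 1)"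
        using pos[of t0] t0 by (intro sum_mono) (force simp: H'_def)
      then have "(\<Sum>i\<in>{1..n}. 1 / real_of_int (units s i t0)) * target \<le> real n * target"
        using target_ge_1 by (intro mult_right_mono) auto
      with big[of t0] t0 have "real n * 1 < real n * target" by (simp add: H'_def)
      then have "1 < target" using n by simp
      moreover have "target = max (\<sigma>\<^sup>2 / (real n * \<epsilon>)) 1"
        unfolding target_def unfolding c by simp
      ultimately have target: "target = \<sigma>\<^sup>2 / (real n * \<epsilon>)" "1 < \<sigma>\<^sup>2 / (real n * \<epsilon>)"
        by (auto simp: max_def split: if_splits)
      then have \<sigma>: "\<sigma>\<^sup>2 > 0" by (cases "\<sigma> = 0") auto
      \<comment> \<open>In terms of this threshold, enough work at a time in \<open>H'\<close> means
        that the reciprocals sum to at most \<theta>.\<close>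
      define \<theta> where "\<theta> = real n / target"
      have \<theta>: "0 < \<theta>" "\<theta> = (real n)\<^sup>2 * \<epsilon> / \<sigma>\<^sup>2"
      proof -
        show "0 < \<theta>" using n target_ge_1 by (simp add: \<theta>_def)
        show "\<theta> = (real n)\<^sup>2 * \<epsilon> / \<sigma>\<^sup>2" by (simp add: \<theta>_def target(1) power2_eq_square)
      qed
      define R where "R = (\<Sum>i\<in>{1..n}. \<rho> i)"
      \<comment> \<open>The reciprocals decrease in time, so the finitely many infima are approached
        at one common time \<open>u\<close>. If they summed to less than \<theta>, the work at
        \<open>u\<close> would be enough.\<close>
      have R: "\<theta> \<le> R"
      proof (rule ccontr)
        assume "\<not> \<theta> \<le> R"
        define \<delta> where "\<delta> = (\<theta> - R) / real n"
        have \<delta>: "\<delta> > 0" "R + real n * \<delta> = \<theta>" using \<open>\<not> \<theta> \<le> R\<close> n by (auto simp: \<delta>_def)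
        have "\<exists>t\<in>H'. 1 / real_of_int (units s i t) < \<rho> i + \<delta>" if "i \<in> {1..n}" for i
          using cINF_less_iff[OF H'_ne bdd[OF that], of "\<rho> i + \<delta>"] \<delta>(1) by (simp add: \<rho>_def)
        then obtain U where U: "\<And>i. i \<in> {1..n} \<Longrightarrow> U i \<in> H' \<and> 1 / real_of_int (units s i (U i)) < \<rho> i + \<delta>"
          by metis
        define u where "u = Max (U ` {1..n})"
        have "u \<in> U ` {1..n}" unfolding u_def using n by (intro Max_in) auto
        then have uH: "u \<in> H'" using U by auto
        have le: "1 / real_of_int (units s i u) \<le> \<rho> i + \<delta>" if i: "i \<in> {1..n}" for i
        proof -
          have "U i \<le> u" unfolding u_def using i by simp
          then have "units s i (U i) \<le> units s i u"
            using U[OF i] H0[of "U i"] by (intro units_mono[OF i]) (auto simp: H'_def)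
          then have "1 / real_of_int (units s i u) \<le> 1 / real_of_int (units s i (U i))"
            using U[OF i] pos[OF _ i, of "U i"] by (intro divide_left_mono) auto
          with U[OF i] show ?thesis by simp
        qed
        have "(\<Sum>i\<in>{1..n}. 1 / real_of_int (units s i u)) \<le> (\<Sum>i\<in>{1..n}. \<rho> i + \<delta>)"
          by (intro sum_mono le)
        also have "\<dots> = \<theta>" using \<delta>(2) by (simp add: sum.distrib R_def)
        finally have "(\<Sum>i\<in>{1..n}. 1 / real_of_int (units s i u)) * target \<le> \<theta> * target"
          using target_ge_1 by (intro mult_right_mono) auto
        also have "\<dots> = real n" using target_ge_1 by (simp add: \<theta>_def)
        finally show False using big[OF uH] by simp
      qed
      have R0: "0 < R" using R \<theta> by simp
      define w where "w i = (if i \<in> {1..n} then \<rho> i / R else 0)" for i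
      \<comment> \<open>As \<open>1 / \<theta> = \<sigma>^2 / (n^2 \<epsilon>)\<close>, the argument
        of the floor is exactly the bound that the variance puts on \<open>B i - 1\<close>. For
        weight 0 the division gives 0 and \<open>B i = 1\<close>.\<close>
      define B where "B i = 1 + nat \<lfloor>1 / (32 * \<theta> * w i)\<rfloor>" for i
      have w0: "0 \<le> w i" for i using \<rho>(1) R0 by (simp add: w_def)
      show ?thesis
      proof (intro exI[of _ w] exI[of _ B] conjI allI impI ballI)
        show "0 \<le> w i" for i by (rule w0)
        show "(\<Sum>i\<in>{1..n}. w i) = 1"
          using R0 by (simp add: w_def R_def flip: sum_divide_distrib)
        show "1 \<le> B i" for i by (simp add: B_def)
        show "32 * (real n)\<^sup>2 * \<epsilon> * w i * (real (B i) - 1) \<le> \<sigma>\<^sup>2" for i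
        proof (cases "w i = 0")
          case False
          then have wi: "0 < w i" using w0[of i] by simp
          have "real (B i) - 1 \<le> 1 / (32 * \<theta> * w i)"
            using wi \<theta>(1) of_nat_floor[of "1 / (32 * \<theta> * w i)"] by (simp add: B_def)
          then have "32 * (real n)\<^sup>2 * \<epsilon> * w i * (real (B i) - 1)
              \<le> 32 * (real n)\<^sup>2 * \<epsilon> * w i * (1 / (32 * \<theta> * w i))"
            using wi \<epsilon> by (intro mult_left_mono) auto
          also have "\<dots> = \<sigma>\<^sup>2"
            unfolding \<theta>(2) using wi \<epsilon> n \<sigma> by (simp add: field_simps)
          finally show ?thesis .
        qed simp
        fix t assume t: "0 \<le> t" "ereal t < tau m"
        have "w i * real (jobs m i t) / real (B i) \<le> w i * (1 / 4)" if i: "i \<in> {1..n}" for i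
        proof (cases "w i = 0")
          case False
          then have wi: "0 < w i" using w0[of i] by simp
          then have \<rho>pos: "0 < \<rho> i" using R0 i by (simp add: w_def zero_less_divide_iff)
          define t' where "t' = max t t0"
          have t': "t' \<in> H'" using t t0 by (auto simp: t'_def H'_def H_def max_def)
          have J: "real (jobs m i t) \<le> real (jobs m i t')"
            using jobs_mono[OF i t(1), of t' m] by (simp add: t'_def)
          have "128 * real (jobs m i t') \<le> real_of_int (units s i t')"
            using jobs_le[of t' i] t' i by (simp add: H'_def)
          also have "\<dots> \<le> 1 / \<rho> i"
            using \<rho>(2)[OF i t'] pos[OF t' i] \<rho>pos by (simp add: field_simps)
          finally have Jt: "real (jobs m i t) \<le> 1 / (128 * \<rho> i)" using J by simp
          have "1 / (32 * \<theta> * w i) \<le> real (B i)"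
            using real_nat_ceiling_ge wi \<theta>(1) by (simp add: B_def) linarith
          then have "w i * real (jobs m i t) / real (B i)
              \<le> w i * (1 / (128 * \<rho> i)) / (1 / (32 * \<theta> * w i))"
            using Jt wi \<theta>(1) \<rho>pos by (intro frac_le mult_left_mono mult_nonneg_nonneg) auto
          \<comment> \<open>The quarter is \<open>32 / 128\<close>, which explains the value of
            \<open>c3\<close>.\<close>
          also have "\<dots> = w i * (\<theta> / R * (1 / 4))"
            using \<rho>pos R0 i by (simp add: w_def field_simps)
          also have "\<dots> \<le> w i * (1 * (1 / 4))"
            using R R0 wi by (intro mult_left_mono mult_right_mono) auto
          finally show ?thesis by simp
        qed simp
        then have "(\<Sum>i\<in>{1..n}. w i * real (jobs m i t) / real (B i)) \<le> (\<Sum>i\<in>{1..n}. w i * (1 / 4))"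
          by (intro sum_mono)
        also have "\<dots> = 1 / 4"
          unfolding sum_distrib_right[symmetric] \<open>(\<Sum>i\<in>{1..n}. w i) = 1\<close> by simp
        finally show "(\<Sum>i\<in>{1..n}. w i * real (jobs m i t) / real (B i)) \<le> 1 / 4" .
      qed
    qed
  qed
qed

end

subsection \<open>The hard instance\<close>

text \<open>
  The part of stage \<open>m\<close> held by worker \<open>i\<close> is split evenly into \<open>B m i\<close> coordinates, numbered
  by \<open>idx\<close>. Only the stage in \<open>front\<close>, of which there is at most one, is shown with noise.
\<close>

locale hard = chain d K st al + work n V 1 128 \<sigma> \<epsilon>
  for d K st al n V \<sigma> \<epsilon> +
  fixes wk idx :: "nat \<Rightarrow> nat" and w :: "nat \<Rightarrow> nat \<Rightarrow> real" and B :: "nat \<Rightarrow> nat \<Rightarrow> nat"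
    and lam L :: real
  assumes K: "1 \<le> K" and lam: "0 < lam" and L: "0 < L" and \<epsilon>: "0 < \<epsilon>"
    and lam_L: "(lam * L / 256)\<^sup>2 = 128 * \<epsilon>"
    and wk_range: "c < d \<Longrightarrow> wk c \<in> {1..n}"
    and idx_less: "c < d \<Longrightarrow> idx c < B (st c) (wk c)"
    and idx_inj: "c < d \<Longrightarrow> c' < d \<Longrightarrow> st c = st c' \<Longrightarrow> wk c = wk c' \<Longrightarrow> idx c = idx c' \<Longrightarrow> c = c'"
    and al_sq: "c < d \<Longrightarrow> (al c)\<^sup>2 = w (st c) (wk c) / real (B (st c) (wk c))"
    and w_nonneg: "0 \<le> w m i" and B_ge_1: "1 \<le> B m i"
    and variance: "m \<in> {1..K} \<Longrightarrow> i \<in> {1..n} \<Longrightarrow>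
      32 * (real n)\<^sup>2 * \<epsilon> * w m i * (real (B m i) - 1) \<le> \<sigma>\<^sup>2"
    and jobs_small: "m \<in> {1..K} \<Longrightarrow> 0 \<le> t \<Longrightarrow> ereal t < tau m \<Longrightarrow>
      (\<Sum>i\<in>{1..n}. w m i * real (jobs m i t) / real (B m i)) \<le> 1 / 4"
begin

definition own :: "nat \<Rightarrow> nat set" where
  "own i = {c. c < d \<and> wk c = i}"

definition sc :: "vect \<Rightarrow> vect" where
  "sc x = (\<lambda>j. x j / lam)"

text \<open>The factor \<open>real n\<close> cancels the average over the workers; it is also the
  source of \<open>n^2\<close> in the variance condition. The scaling turns a 256-Lipschitz gradient
  into an \<open>L\<close>-Lipschitz one.\<close>

definition F :: "nat \<Rightarrow> vect \<Rightarrow> real" where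
  "F i x = real n * (lam\<^sup>2 * L / 256) * obj (own i) (sc x)"

definition G :: "nat \<Rightarrow> vect \<Rightarrow> vect" where
  "G i x = (\<lambda>c. real n * (lam * L / 256) * gobj (own i) (sc x) c)"

definition front :: "nat \<Rightarrow> vect \<Rightarrow> bool" where
  "front m x \<longleftrightarrow> gate (m - 1) (sc x) \<noteq> 0 \<and> (\<forall>m'\<in>{m..K}. gate m' (sc x) = 0)"

definition noisy :: "nat \<Rightarrow> vect \<Rightarrow> nat \<Rightarrow> bool" where
  "noisy i x c \<longleftrightarrow> c \<in> own i \<and> x c = 0 \<and> front (st c) x"

definition g :: "nat \<Rightarrow> vect \<Rightarrow> real \<Rightarrow> real \<Rightarrow> vect" where
  "g i x \<xi> t = (\<lambda>c. (if noisy i x c then (if \<xi> = real (idx c) then real (B (st c) i) else 0) else 1)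
     * G i x c)"

definition part :: "nat \<Rightarrow> nat \<Rightarrow> nat set" where
  "part m i = blk m \<inter> own i"

section \<open>Revealed coordinates and the invariant of the protocol\<close>

lemma G_Rd: "G i x \<in> Rd d"
  using gobj_Rd by (auto simp: in_Rd G_def)

lemma g_Rd: "g i x \<xi> t \<in> Rd d"
  using G_Rd[of i x] by (auto simp: in_Rd g_def)

lemma finite_part: "finite (part m i)"
  by (simp add: part_def finite_blk)

lemma g_support:
  assumes "c < d" "x c = 0" "g i x \<xi> t c \<noteq> 0"
  shows "wk c = i" "gate (st c - 1) (sc x) \<noteq> 0" "front (st c) x \<Longrightarrow> \<xi> = real (idx c)"
proof -
  have "gobj (own i) (sc x) c \<noteq> 0" using assms(3) by (auto simp: g_def G_def)
  moreover have "sc x c = 0" using assms(2) by (simp add: sc_def)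
  ultimately show i: "wk c = i" and "gate (st c - 1) (sc x) \<noteq> 0"
    by (auto simp: gobj_at_zero own_def split: if_splits)
  show "\<xi> = real (idx c)" if "front (st c) x"
    using assms i that by (auto simp: g_def noisy_def own_def split: if_splits)
qed

text \<open>\<open>S\<close> is the set of coordinates seen so far. A stage whose period is over is
  left unconstrained.\<close>

definition rev_ok :: "nat set \<Rightarrow> real \<Rightarrow> bool" where
  "rev_ok S t \<longleftrightarrow> (\<forall>m\<in>{1..K}. ereal t < tau m \<longrightarrow> (\<forall>i\<in>{1..n}. card (S \<inter> part m i) \<le> jobs m i t))"

text \<open>For a pending job the revealed coordinates are compared with the budget at its start
  \<open>t'\<close>, not at the current time; the work done until its completion then pays for what
  its answer reveals. A job from before period \<open>m\<close> needs no such count, since gate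
  \<open>m - 1\<close> was closed at its stored point.\<close>

definition job_ok :: "nat \<Rightarrow> nat set \<Rightarrow> real \<Rightarrow> oracle_state \<Rightarrow> bool" where
  "job_ok i S t = (\<lambda>(t', x, q). q \<longrightarrow> x \<in> Rd d \<and> supp d x \<subseteq> S \<and> 0 \<le> t' \<and> t' \<le> t \<and>
     (\<forall>m\<in>{1..K}. ereal t' < tau m \<longrightarrow> gate m (sc x) = 0 \<and>
        (ereal t < tau m \<longrightarrow> tau (m - 1) \<le> ereal t' \<longrightarrow> card (S \<inter> part m i) \<le> jobs m i t')))"

lemma ereal_le_less: "t \<le> t' \<Longrightarrow> ereal t' < a \<Longrightarrow> ereal t < a"
  using le_less_trans[of "ereal t" "ereal t'" a] by simp

lemma rev_ok_mono: "rev_ok S t \<Longrightarrow> 0 \<le> t \<Longrightarrow> t \<le> t' \<Longrightarrow> rev_ok S t'"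
  unfolding rev_ok_def by (meson ereal_le_less jobs_mono order_trans)

text \<open>A coordinate in \<open>part m i\<close> weighs \<open>w m i / B m i\<close>, so the
  count in \<open>rev_ok\<close> turns into the weighted sum of \<open>jobs_small\<close>, and at
  most a quarter of the stage has been seen.\<close>

lemma gate_closed_if_rev_ok:
  assumes S: "rev_ok S t" and t: "0 \<le> t" and m: "m \<in> {1..K}" "ereal t < tau m" and x: "supp d x \<subseteq> S"
  shows "gate m (sc x) = 0"
proof (rule gate_closed)
  have fin: "finite (S \<inter> blk m)" by (simp add: finite_blk)
  have "(\<Sum>c\<in>blk m \<inter> {c. sc x c \<noteq> 0}. (al c)\<^sup>2) \<le> (\<Sum>c\<in>S \<inter> blk m. (al c)\<^sup>2)"
    using x lam by (intro sum_mono2 fin) (auto simp: supp_def sc_def blk_def)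
  also have "\<dots> = (\<Sum>i\<in>{1..n}. \<Sum>c | c \<in> S \<inter> blk m \<and> wk c = i. (al c)\<^sup>2)"
    using wk_range by (intro sum.group[symmetric] fin) (auto simp: blk_def)
  also have "\<dots> = (\<Sum>i\<in>{1..n}. \<Sum>c\<in>S \<inter> part m i. w m i / real (B m i))"
    using al_sq by (intro sum.cong) (auto simp: part_def blk_def own_def)
  also have "\<dots> = (\<Sum>i\<in>{1..n}. w m i * real (card (S \<inter> part m i)) / real (B m i))"
    by (simp add: mult.commute)
  also have "\<dots> \<le> (\<Sum>i\<in>{1..n}. w m i * real (jobs m i t) / real (B m i))"
    using S m w_nonneg by (intro sum_mono divide_right_mono mult_left_mono) (auto simp: rev_ok_def)
  also have "\<dots> \<le> 1 / 4" by (rule jobs_small[OF m(1) t m(2)])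
  finally show "(\<Sum>c\<in>blk m \<inter> {c. sc x c \<noteq> 0}. (al c)\<^sup>2) \<le> 1 / 4" .
qed (use m in simp)

text \<open>While the job of worker \<open>i\<close> is pending, other workers may enlarge
  \<open>S\<close>, but not inside the parts of \<open>i\<close> in unfinished stages.\<close>

lemma job_ok_later:
  assumes J: "job_ok i S t s" and t: "t \<le> t'" and S: "S \<subseteq> S'"
    and eq: "\<And>m. m \<in> {1..K} \<Longrightarrow> ereal t' < tau m \<Longrightarrow> S' \<inter> part m i = S \<inter> part m i"
  shows "job_ok i S' t' s"
  using J t S eq ereal_le_less[OF t] unfolding job_ok_def by (force split: prod.splits)

lemma job_ok_start:
  assumes S: "rev_ok S t" and t: "0 \<le> t" "t \<le> t'" and i: "i \<in> {1..n}"
    and x: "x \<in> Rd d" "supp d x \<subseteq> S"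
  shows "job_ok i S t' (t', x, True)"
proof -
  have S': "rev_ok S t'" using rev_ok_mono[OF S t] .
  then show ?thesis
    using x t i gate_closed_if_rev_ok[OF S'] by (auto simp: job_ok_def rev_ok_def)
qed

text \<open>A new coordinate of stage \<open>m\<close> belongs to the calling worker and lies behind
  an open gate \<open>m - 1\<close>. The gates from \<open>m\<close> on are closed at the stored
  point, so the stage is in front and only coordinates with index \<xi> appear; injectivity of
  \<open>idx\<close> leaves one. The open gate places the start of the job within period
  \<open>m\<close>, and \<open>jobs_Suc_le\<close> provides room for this coordinate.\<close>

lemma reveal:
  assumes J: "job_ok i S t (t0, x, True)" and S: "rev_ok S t" and t: "0 \<le> t" "t \<le> t'"
    and i: "i \<in> {1..n}" and V: "1 \<le> V i t' - V i t0" and m: "m \<in> {1..K}" "ereal t' < tau m"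
    and j: "j \<in> {1..n}"
  shows "card ((S \<union> supp d (g i x \<xi> t')) \<inter> part m j) \<le> jobs m j t'"
    and "j \<noteq> i \<Longrightarrow> (S \<union> supp d (g i x \<xi> t')) \<inter> part m j = S \<inter> part m j"
proof -
  let ?N = "(supp d (g i x \<xi> t') - S) \<inter> part m j"
  have x: "supp d x \<subseteq> S" and t0: "0 \<le> t0" "t0 \<le> t'" using J t by (auto simp: job_ok_def)
  have closed: "gate m' (sc x) = 0" if "m' \<in> {1..K}" "ereal t0 < tau m'" for m'
    using J that by (auto simp: job_ok_def)
  have split: "(S \<union> supp d (g i x \<xi> t')) \<inter> part m j = (S \<inter> part m j) \<union> ?N" by blast
  have N: "wk c = i" "gate (m - 1) (sc x) \<noteq> 0" "\<xi> = real (idx c)" "c < d" "st c = m" "wk c = j" if "c \<in> ?N" for c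
  proof -
    have c: "c < d" "x c = 0" "g i x \<xi> t' c \<noteq> 0" using that x by (auto simp: supp_def)
    show "c < d" "st c = m" "wk c = j" using that by (auto simp: part_def blk_def own_def)
    then show "wk c = i" and opn: "gate (m - 1) (sc x) \<noteq> 0" using g_support[OF c] by auto
    have "gate m' (sc x) = 0" if "m' \<in> {m..K}" for m'
      using m that t0 tau_mono[of m m'] less_le_trans[OF m(2)]
      by (intro closed) (auto intro: ereal_le_less)
    with opn have "front (st c) x" by (simp add: front_def \<open>st c = m\<close>)
    with g_support(3)[OF c] show "\<xi> = real (idx c)" .
  qed
  have ji: "S \<inter> part m j = (S \<union> supp d (g i x \<xi> t')) \<inter> part m j" if "j \<noteq> i"
    using N that unfolding split by blast
  then show "j \<noteq> i \<Longrightarrow> (S \<union> supp d (g i x \<xi> t')) \<inter> part m j = S \<inter> part m j" by simp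
  have old: "card (S \<inter> part m j) \<le> jobs m j t'"
    using rev_ok_mono[OF S t] m j by (auto simp: rev_ok_def)
  show "card ((S \<union> supp d (g i x \<xi> t')) \<inter> part m j) \<le> jobs m j t'"
  proof (cases "?N = {}")
    case True
    then show ?thesis unfolding split using old by simp
  next
    case False
    then obtain c where c: "c \<in> ?N" by blast
    then have "?N \<subseteq> {c}" using N idx_inj by (metis of_nat_eq_iff singletonI subsetI)
    then have N1: "card ?N \<le> 1" using card_mono[of "{c}" ?N] by simp
    have "tau (m - 1) \<le> ereal t0"
    \<comment> \<open>Gate 0 is always open and yields no information, but \<open>tau 0 = 0\<close>
      bounds every start time.\<close>
    proof (cases "m = 1")
      case False
      then have "m - 1 \<in> {1..K}" using m by auto
      with closed[of "m - 1"] N(2)[OF c] show ?thesis by force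
    qed (use t0 in simp)
    moreover have "ereal t0 < tau m" "ereal t < tau m" using ereal_le_less m t0 t by blast+
    ultimately have "card (S \<inter> part m i) \<le> jobs m i t0" using J m by (auto simp: job_ok_def)
    moreover have "Suc (jobs m i t0) \<le> jobs m i t'"
      using jobs_Suc_le[OF i t0 _ V] \<open>tau (m - 1) \<le> ereal t0\<close> by blast
    moreover have "j = i" using N[OF c] by simp
    moreover have "card ((S \<inter> part m j) \<union> ?N) \<le> card (S \<inter> part m j) + card ?N"
      by (rule card_Un_le)
    ultimately show ?thesis unfolding split using N1 by simp
  qed
qed

context
  fixes A :: algorithm
  assumes zr: "zero_respecting d n A"
begin

definition shown :: "vect list \<Rightarrow> nat set" where
  "shown gs = (\<Union>h\<in>set gs. supp d h)"

definition invar :: "real \<Rightarrow> vect list \<times> (nat \<Rightarrow> oracle_state) \<Rightarrow> bool" where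
  "invar t = (\<lambda>(gs, s). set gs \<subseteq> Rd d \<and> 0 \<le> t \<and> rev_ok (shown gs) t \<and>
     (\<forall>i\<in>{1..n}. job_ok i (shown gs) t (s i)))"

text \<open>Only a completed job extends the knowledge. Every other call returns the zero vector and
  leaves the worker with an empty state, the same job, or a job started at the current time.\<close>

lemma invar_step:
  assumes I: "invar t (gs, s)" and A: "A gs = (t', i, c, x)" and t: "t \<le> t'"
    and q: "query_oracle (V i) (g i) t' x (s i) c \<xi> = (si, h)"
  shows "invar t' (gs @ [h], s(i := si))"
proof -
  have gs: "set gs \<subseteq> Rd d" and t0: "0 \<le> t" and rev: "rev_ok (shown gs) t"
    and J: "\<And>i. i \<in> {1..n} \<Longrightarrow> job_ok i (shown gs) t (s i)"
    using I by (auto simp: invar_def)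
  have i: "i \<in> {1..n}" and x: "x \<in> Rd d" "supp d x \<subseteq> shown gs"
    using zr gs A unfolding zero_respecting_def shown_def by (force dest: spec[of _ gs])+
  have idle: "job_ok j S u init_state" for j S u by (simp add: job_ok_def init_state_def)
  obtain st0 sx sq where s: "s i = (st0, sx, sq)" by (cases "s i") auto
  show ?thesis
  proof (cases "\<not> c \<and> sq \<and> 1 \<le> V i t' - V i st0")
    case False
    then have h: "h = (\<lambda>_. 0)" and si: "si = init_state \<or> si = (t', x, True) \<or> si = s i"
      using q s by (auto simp: query_oracle_def split: if_splits)
    have "h \<in> Rd d" by (simp add: h in_Rd)
    have sh: "shown (gs @ [h]) = shown gs" by (auto simp: shown_def h supp_def)
    have "job_ok j (shown gs) t' (s j)" if "j \<in> {1..n}" for j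
      using job_ok_later[OF J[OF that] t order_refl] by simp
    moreover from this[OF i] have "job_ok i (shown gs) t' si"
      using si idle job_ok_start[OF rev t0 t i x] by auto
    ultimately show ?thesis
      using gs t0 t rev_ok_mono[OF rev t0 t] \<open>h \<in> Rd d\<close> by (auto simp: invar_def sh)
  next
    case True
    then have h: "h = g i sx \<xi> t'" and si: "si = init_state" and V: "1 \<le> V i t' - V i st0"
      using q s by (auto simp: query_oracle_def)
    have sh: "shown (gs @ [h]) = shown gs \<union> supp d h" by (auto simp: shown_def)
    have Ji: "job_ok i (shown gs) t (st0, sx, True)" using J[OF i] s True by simp
    note r = reveal[where \<xi>=\<xi>, OF Ji rev t0 t i V, folded h]
    have "rev_ok (shown gs \<union> supp d h) t'" using r(1) by (auto simp: rev_ok_def)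
    moreover have "job_ok j (shown gs \<union> supp d h) t' ((s(i := si)) j)" if j: "j \<in> {1..n}" for j
    proof (cases "j = i")
      case False
      then show ?thesis using job_ok_later[OF J[OF j] t _ r(2)[OF _ _ j]] by auto
    qed (simp add: si idle)
    ultimately show ?thesis
      using gs t0 t g_Rd[of i sx \<xi> t'] unfolding h[symmetric] by (simp add: invar_def sh)
  qed
qed

lemma invar_protocol: "invar (protocol_time V g A \<omega> k) (protocol V g A \<omega> k)"
proof (induction k)
  case 0
  have "rev_ok (shown []) 0" by (simp add: rev_ok_def shown_def)
  then show ?case by (simp add: invar_def protocol_time_def job_ok_def init_state_def)
next
  case (Suc k)
  obtain gs s where p: "protocol V g A \<omega> k = (gs, s)" by fastforce
  obtain t' i c x where A: "A gs = (t', i, c, x)" by (cases "A gs") auto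
  obtain si h where q: "query_oracle (V i) (g i) t' x (s i) c (\<omega> k) = (si, h)" by fastforce
  have gs: "set gs \<subseteq> Rd d" using Suc p by (simp add: invar_def)
  have "protocol_time V g A \<omega> k \<le> t'"
  proof (cases k)
    case 0
    then show ?thesis
      using zr A gs unfolding zero_respecting_def by (force simp: protocol_time_def dest: spec[of _ gs])
  next
    case (Suc k')
    obtain gs' s' where p': "protocol V g A \<omega> k' = (gs', s')" by fastforce
    then obtain h' where "gs = gs' @ [h']"
      using p Suc by (auto split: prod.splits)
    then show ?thesis
      using zr gs A Suc p' unfolding zero_respecting_def by (force simp: protocol_time_def)
  qed
  with invar_step[where gs=gs and s=s, OF _ A _ q] Suc p show ?case
    by (simp add: protocol_time_def A q)
qed

text \<open>The point of index \<open>k\<close> is built from the first \<open>k\<close> answers,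
  the last of which was requested at the time of index \<open>k\<close>; this is the state that the
  invariant describes. It holds for each fixed \<omega>.\<close>

lemma last_gate_closed:
  assumes "ereal (protocol_time V g A \<omega> k) < tau K"
  shows "gate K (sc (protocol_point V g A \<omega> k)) = 0"
proof -
  obtain gs s where p: "protocol V g A \<omega> k = (gs, s)" by fastforce
  obtain t' i c x where A: "A gs = (t', i, c, x)" by (cases "A gs") auto
  have I: "invar (protocol_time V g A \<omega> k) (gs, s)" using invar_protocol[of \<omega> k] p by simp
  then have "supp d x \<subseteq> shown gs"
    using zr A unfolding zero_respecting_def shown_def invar_def by (force dest: spec[of _ gs])
  with I assms K show ?thesis
    by (intro gate_closed_if_rev_ok[of "shown gs" "protocol_time V g A \<omega> k"])
       (auto simp: invar_def protocol_point_def p A)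
qed

end

end

lemma vnorm_cmult: "vnorm d (\<lambda>c. k * x c) = \<bar>k\<bar> * vnorm d x"
  by (simp add: vnorm_def L2_set_def power_mult_distrib real_sqrt_mult flip: sum_distrib_left)

section \<open>The law of the noise and measurability for an arbitrary algorithm\<close>

lemma sets_PiM_count_space_finite:
  assumes J: "finite J" and S: "countable S"
  shows "sets (PiM J (\<lambda>_. count_space S)) = Pow (PiE J (\<lambda>_. S))"
proof
  show "sets (PiM J (\<lambda>_. count_space S)) \<subseteq> Pow (PiE J (\<lambda>_. S))"
    using sets.space_closed[of "PiM J (\<lambda>_. count_space S)"] by (simp add: space_PiM)
  show "Pow (PiE J (\<lambda>_. S)) \<subseteq> sets (PiM J (\<lambda>_. count_space S))"
  proof
    fix X assume X: "X \<in> Pow (PiE J (\<lambda>_. S))"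
    have "{x} \<in> sets (PiM J (\<lambda>_. count_space S))" if "x \<in> X" for x
    proof -
      have "x \<in> PiE J (\<lambda>_. S)" using that X by auto
      then have "{x} = PiE J (\<lambda>j. {x j})" by (simp add: PiE_iff PiE_singleton)
      also have "\<dots> \<in> sets (PiM J (\<lambda>_. count_space S))"
        using \<open>x \<in> PiE J (\<lambda>_. S)\<close> by (intro sets_PiM_I_finite J) (auto simp: PiE_iff)
      finally show ?thesis .
    qed
    moreover have "countable X"
      using X countable_PiE[OF J, of "\<lambda>_. S"] S by (meson PowD countable_subset)
    ultimately show "X \<in> sets (PiM J (\<lambda>_. count_space S))" by (rule sets.countable)
  qed
qed

lemma protocol_cong: "(\<And>j. j < k \<Longrightarrow> \<omega> j = \<omega>' j) \<Longrightarrow> protocol V g A \<omega> k = protocol V g A \<omega>' k"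
  by (induction k) (simp_all split: prod.split)

text \<open>The algorithm is an arbitrary function, so measurability has to come from the samples.
  Countably many values with all subsets measurable make every function of finitely many samples
  measurable.\<close>

definition noise_space :: "real measure" where
  "noise_space = count_space (range real)"

definition uniform_noise :: "nat \<Rightarrow> real measure" where
  "uniform_noise k = distr (measure_pmf (pmf_of_set {..<k})) noise_space real"

lemma real_measurable: "real \<in> measurable (measure_pmf p) noise_space"
  by (simp add: noise_space_def measurable_pmf_measure1)

lemma uniform_noise_props:
  "prob_space (uniform_noise k)" "sets (uniform_noise k) = sets noise_space"
  unfolding uniform_noise_def using real_measurable
  by (auto intro!: prob_space.prob_space_distr measure_pmf.prob_space_axioms)

lemma uniform_noise_integral:
  fixes f :: "real \<Rightarrow> real"
  assumes "0 < k"
  shows "integrable (uniform_noise k) f"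
    and "(\<integral>\<xi>. f \<xi> \<partial>uniform_noise k) = (\<Sum>b<k. f (real b)) / real k"
proof -
  have f: "f \<in> borel_measurable noise_space" by (simp add: noise_space_def)
  have ne: "{..<k} \<noteq> {}" using assms by auto
  show "integrable (uniform_noise k) f"
    unfolding uniform_noise_def using ne
    by (subst integrable_distr_eq[OF real_measurable f])
       (intro integrable_measure_pmf_finite, simp add: set_pmf_of_set[OF ne])
  show "(\<integral>\<xi>. f \<xi> \<partial>uniform_noise k) = (\<Sum>b<k. f (real b)) / real k"
    unfolding uniform_noise_def using ne
    by (subst integral_distr[OF real_measurable f]) (simp add: integral_pmf_of_set)
qed

context
  fixes V :: "nat \<Rightarrow> real \<Rightarrow> real" and g :: "nat \<Rightarrow> vect \<Rightarrow> real \<Rightarrow> real \<Rightarrow> vect" and A :: algorithm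
    and bs :: "nat \<Rightarrow> vect \<Rightarrow> nat"
begin

text \<open>The kernel of a round depends on finitely many earlier samples, and every subset of that
  finite product is measurable.\<close>

lemma Ionescu_Tulcea_noise:
  "Ionescu_Tulcea (noise_kernel V (\<lambda>i x t. uniform_noise (bs i x)) g A) (\<lambda>_. noise_space)"
proof (rule Ionescu_Tulcea.intro)
  have un: "\<exists>k. noise_kernel V (\<lambda>i x t. uniform_noise (bs i x)) g A m \<omega> = uniform_noise k" for m \<omega>
    by (auto simp: noise_kernel_def split: prod.splits)
  show "prob_space (noise_kernel V (\<lambda>i x t. uniform_noise (bs i x)) g A m \<omega>)"
    if "\<omega> \<in> space (PiM {0..<m} (\<lambda>_. noise_space))" for m \<omega>
    using un[of m \<omega>] uniform_noise_props(1) by auto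
  fix m
  have "noise_kernel V (\<lambda>i x t. uniform_noise (bs i x)) g A m \<omega> \<in> space (subprob_algebra noise_space)" for \<omega>
    using un[of m \<omega>] uniform_noise_props
    by (auto simp: space_subprob_algebra intro: prob_space_imp_subprob_space)
  moreover have "sets (PiM {0..<m} (\<lambda>_. noise_space)) = Pow (space (PiM {0..<m} (\<lambda>_. noise_space)))"
    unfolding noise_space_def by (subst sets_PiM_count_space_finite) (auto simp: space_PiM)
  ultimately show "noise_kernel V (\<lambda>i x t. uniform_noise (bs i x)) g A m
      \<in> PiM {0..<m} (\<lambda>_. noise_space) \<rightarrow>\<^sub>M subprob_algebra noise_space"
    by (intro measurableI) auto
qed

abbreviation law :: "(nat \<Rightarrow> real) measure" where
  "law \<equiv> noise_law V noise_space (\<lambda>i x t. uniform_noise (bs i x)) g A"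

lemma sets_law: "sets law = sets (PiM UNIV (\<lambda>_. noise_space))"
proof -
  interpret Ionescu_Tulcea "noise_kernel V (\<lambda>i x t. uniform_noise (bs i x)) g A" "\<lambda>_. noise_space"
    by (rule Ionescu_Tulcea_noise)
  show ?thesis by (simp add: noise_law_def)
qed

text \<open>The image of the limit under restriction to no coordinates is the measure on the empty
  product, which has mass 1; taking images preserves the total mass.\<close>

lemma prob_space_law: "prob_space law"
proof -
  interpret Ionescu_Tulcea "noise_kernel V (\<lambda>i x t. uniform_noise (bs i x)) g A" "\<lambda>_. noise_space"
    by (rule Ionescu_Tulcea_noise)
  have "prob_space (distr PF.lim (PiM {} (\<lambda>_. noise_space)) (\<lambda>x. restrict x {}))"
    by (subst distr_lim) (auto intro: PF.prob_space_P)
  moreover have "(\<lambda>x. restrict x {}) \<in> measurable PF.lim (PiM {} (\<lambda>_. noise_space))"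
    by (subst measurable_cong_sets[OF PF.sets_lim refl]) (rule measurable_restrict_subset, simp)
  ultimately show ?thesis
    unfolding noise_law_def by (rule prob_space_distrD[rotated])
qed

text \<open>Such an event is the preimage, under restriction to the first \<open>k\<close> samples,
  of a subset of a space in which all subsets are measurable.\<close>

lemma sets_law_finite_dependence:
  assumes P: "\<And>\<omega> \<omega>'. (\<And>j. j < k \<Longrightarrow> \<omega> j = \<omega>' j) \<Longrightarrow> P \<omega> = P \<omega>'"
  shows "{\<omega> \<in> space law. P \<omega>} \<in> sets law"
proof -
  have space: "space law = space (PiM UNIV (\<lambda>_. noise_space))"
    by (rule sets_eq_imp_space_eq[OF sets_law])
  let ?Q = "{\<omega> \<in> space (PiM {0..<k} (\<lambda>_. noise_space)). P \<omega>}"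
  have "?Q \<in> sets (PiM {0..<k} (\<lambda>_. noise_space))"
    unfolding noise_space_def by (subst sets_PiM_count_space_finite) (auto simp: space_PiM)
  then have "(\<lambda>\<omega>. restrict \<omega> {0..<k}) -` ?Q \<inter> space (PiM UNIV (\<lambda>_. noise_space))
      \<in> sets (PiM UNIV (\<lambda>_. noise_space))"
    by (intro measurable_sets[OF measurable_restrict_subset]) auto
  moreover have "P (restrict \<omega> {0..<k}) = P \<omega>" for \<omega> by (rule P) simp
  then have "(\<lambda>\<omega>. restrict \<omega> {0..<k}) -` ?Q \<inter> space (PiM UNIV (\<lambda>_. noise_space))
      = {\<omega> \<in> space law. P \<omega>}"
    by (auto simp: space space_PiM)
  ultimately show ?thesis by (simp add: sets_law)
qed

text \<open>The infimum is below \<open>u\<close> iff some round in time has a value below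
  \<open>u\<close>, a countable union of events that each depend on finitely many samples. Round 0
  is always in time as \<open>T \<ge> 0\<close>, so the index set is nonempty.\<close>

lemma best_grad_norm_integral_ge:
  assumes T: "0 \<le> T"
    and le: "\<And>\<omega> k. ereal (protocol_time V g A \<omega> k) \<le> T \<Longrightarrow>
      a \<le> (vnorm d (grad d f (protocol_point V g A \<omega> k)))\<^sup>2"
  shows "integrable law (best_grad_norm d f V g A T)"
    and "a \<le> (\<integral>\<omega>. best_grad_norm d f V g A T \<omega> \<partial>law)"
proof -
  interpret prob_space law by (rule prob_space_law)
  let ?h = "\<lambda>\<omega> k. (vnorm d (grad d f (protocol_point V g A \<omega> k)))\<^sup>2"
  let ?S = "\<lambda>\<omega>. {k. ereal (protocol_time V g A \<omega> k) \<le> T}"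
  let ?b = "best_grad_norm d f V g A T"
  have 0: "0 \<in> ?S \<omega>" for \<omega> using T by (simp add: protocol_time_def flip: zero_ereal_def)
  have bdd: "bdd_below (?h \<omega> ` ?S \<omega>)" for \<omega> by (intro bdd_belowI2[of _ 0]) simp
  have less: "?b \<omega> < u \<longleftrightarrow> (\<exists>k. ereal (protocol_time V g A \<omega> k) \<le> T \<and> ?h \<omega> k < u)" for \<omega> u
    unfolding best_grad_norm_def using 0[of \<omega>] by (subst cINF_less_iff[OF _ bdd]) auto
  have level: "{\<omega> \<in> space law. ?b \<omega> < u} = (\<Union>k. {\<omega> \<in> space law. ereal (protocol_time V g A \<omega> k) \<le> T \<and> ?h \<omega> k < u})" for u
    unfolding less by blast
  have dep: "protocol_time V g A \<omega> k = protocol_time V g A \<omega>' k \<and> protocol_point V g A \<omega> k = protocol_point V g A \<omega>' k"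
    if "\<And>j. j < k \<Longrightarrow> \<omega> j = \<omega>' j" for \<omega> \<omega>' k
    using protocol_cong[of k \<omega> \<omega>'] protocol_cong[of "k - 1" \<omega> \<omega>'] that
    by (auto simp: protocol_time_def protocol_point_def split: nat.split)
  have "{\<omega> \<in> space law. ereal (protocol_time V g A \<omega> k) \<le> T \<and> ?h \<omega> k < u} \<in> sets law" for k u
  proof (rule sets_law_finite_dependence[of k])
    fix \<omega> \<omega>' :: "nat \<Rightarrow> real" assume "\<And>j. j < k \<Longrightarrow> \<omega> j = \<omega>' j"
    from dep[OF this] show "(ereal (protocol_time V g A \<omega> k) \<le> T \<and> ?h \<omega> k < u)
        = (ereal (protocol_time V g A \<omega>' k) \<le> T \<and> ?h \<omega>' k < u)" by simp
  qed
  then have meas: "?b \<in> borel_measurable law"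
    unfolding borel_measurable_iff_less level by (intro allI sets.countable_UN) auto
  \<comment> \<open>The starting point is chosen before any sample, so its value is one constant for
    all \<omega>; it bounds the infimum from above.\<close>
  have h0: "?h \<omega> 0 = ?h undefined 0" for \<omega> by (simp add: protocol_point_def)
  have bound: "norm (?b \<omega>) \<le> ?h undefined 0" for \<omega>
  proof -
    have "?b \<omega> \<le> ?h \<omega> 0" unfolding best_grad_norm_def by (rule cINF_lower[OF bdd 0])
    moreover have "0 \<le> ?b \<omega>"
      unfolding best_grad_norm_def using 0[of \<omega>] by (intro cINF_greatest) auto
    ultimately show ?thesis unfolding h0[of \<omega>] by simp
  qed
  show int: "integrable law ?b"
    by (rule integrable_const_bound[OF _ meas]) (use bound in auto)
  have "a \<le> ?b \<omega>" for \<omega>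
    unfolding best_grad_norm_def using 0[of \<omega>] le by (intro cINF_greatest) auto
  then show "a \<le> (\<integral>\<omega>. ?b \<omega> \<partial>law)" by (intro integral_ge_const int) auto
qed

end

text \<open>The part of the final statement that follows the choice of the algorithm, with
  \<open>V\<close> and \<open>T\<close> as parameters.\<close>

definition hard_for ::
  "nat \<Rightarrow> nat \<Rightarrow> (nat \<Rightarrow> real \<Rightarrow> real) \<Rightarrow> real \<Rightarrow> real \<Rightarrow> real \<Rightarrow> real \<Rightarrow> algorithm \<Rightarrow> ereal \<Rightarrow> bool" where
  "hard_for d n V L \<Delta> \<epsilon> \<sigma> A T \<longleftrightarrow>
    (\<exists>(M :: (nat \<Rightarrow> vect \<Rightarrow> real) measure)
       (N :: real measure)
       (D :: (nat \<Rightarrow> vect \<Rightarrow> real) \<Rightarrow> nat \<Rightarrow> vect \<Rightarrow> real \<Rightarrow> real measure)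
       (g :: (nat \<Rightarrow> vect \<Rightarrow> real) \<Rightarrow> nat \<Rightarrow> vect \<Rightarrow> real \<Rightarrow> real \<Rightarrow> vect).
       prob_space M \<and>
       (\<forall>i\<in>{1..n}. \<forall>x\<in>Rd d. (\<lambda>F. F i x) \<in> borel_measurable M) \<and>
       (\<forall>F\<in>space M.
          differentiable_Rd d (avg n F) \<and> smooth_with d L (avg n F) \<and>
          (\<exists>fstar::real. (\<forall>x\<in>Rd d. fstar \<le> avg n F x) \<and> avg n F (\<lambda>_. 0) - fstar \<le> \<Delta>) \<and>
          (\<forall>i\<in>{1..n}. differentiable_Rd d (F i)) \<and>
          stochastic_gradients d n \<sigma> F N (D F) (g F) \<and>
          Ionescu_Tulcea (noise_kernel V (D F) (g F) A) (\<lambda>_. N) \<and>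
          integrable (noise_law V N (D F) (g F) A)
            (best_grad_norm d (avg n F) V (g F) A T)) \<and>
       integrable M (\<lambda>F. \<integral>\<omega>. best_grad_norm d (avg n F) V (g F) A T \<omega>
                            \<partial>noise_law V N (D F) (g F) A) \<and>
       (\<integral>F. (\<integral>\<omega>. best_grad_norm d (avg n F) V (g F) A T \<omega>
                 \<partial>noise_law V N (D F) (g F) A) \<partial>M) > \<epsilon>)"

section \<open>Smoothness, gap and variance of the instance\<close>

context hard
begin

text \<open>The number of equally likely samples at \<open>x\<close>. If no stage is in front, the
  choice is arbitrary, but still positive, and the answer is exact.\<close>

definition bs :: "nat \<Rightarrow> vect \<Rightarrow> nat" where
  "bs i x = B (SOME m. m \<in> {1..K} \<and> front m x) i"

text \<open>If \<open>m < m'\<close>, then gate \<open>m' - 1\<close> would have to be closed for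
  \<open>m\<close> and not closed for \<open>m'\<close>.\<close>

lemma front_unique:
  assumes "m \<in> {1..K}" "m' \<in> {1..K}" "front m x" "front m' x"
  shows "m = m'"
proof -
  have "\<not> m < m'" if "m \<in> {1..K}" "m' \<in> {1..K}" "front m x" "front m' x" for m m'
  proof
    assume "m < m'"
    then have "m' - 1 \<in> {m..K}" using that by auto
    with that show False by (auto simp: front_def)
  qed
  with assms show ?thesis by (meson linorder_neqE_nat)
qed

lemma bs_eq: "m \<in> {1..K} \<Longrightarrow> front m x \<Longrightarrow> bs i x = B m i"
  unfolding bs_def by (rule arg_cong[where f="\<lambda>m. B m i"], rule some_equality) (auto intro: front_unique)

lemma bs_pos: "0 < bs i x"
  using B_ge_1 by (simp add: bs_def Suc_le_eq[symmetric])

lemma has_grad_F: "has_grad d (F i) (G i x) x"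
proof -
  have "has_grad d (\<lambda>y. real n * (lam\<^sup>2 * L / 256) * obj (own i) (\<lambda>j. y j / lam))
      (\<lambda>c. real n * (lam\<^sup>2 * L / 256) * (gobj (own i) (\<lambda>j. x j / lam) c / lam)) x"
    by (intro has_grad_cmult has_grad_scale lam has_grad_obj) (auto simp: own_def)
  then show ?thesis
    using lam by (simp add: F_def[abs_def] G_def[abs_def] sc_def power2_eq_square mult.assoc)
qed

lemma avg_F: "avg n F x = lam\<^sup>2 * L / 256 * obj {..<d} (sc x)"
proof -
  have "(\<Sum>i\<in>{1..n}. obj (own i) y) = obj {..<d} y" for y
    unfolding obj_def own_def using wk_range
    by (subst sum.group[of "{..<d}" "{1..n}" wk, symmetric]) auto
  then show ?thesis unfolding avg_def F_def sum_distrib_left[symmetric] using n by simp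
qed

lemma has_grad_avg:
  "has_grad d (avg n F) (\<lambda>c. lam * L / 256 * gobj {..<d} (sc x) c) x"
proof -
  have "has_grad d (\<lambda>y. lam\<^sup>2 * L / 256 * obj {..<d} (\<lambda>j. y j / lam))
      (\<lambda>c. lam\<^sup>2 * L / 256 * (gobj {..<d} (\<lambda>j. x j / lam) c / lam)) x"
    by (intro has_grad_cmult has_grad_scale lam has_grad_obj) auto
  moreover have "avg n F = (\<lambda>y. lam\<^sup>2 * L / 256 * obj {..<d} (\<lambda>j. y j / lam))"
    by (auto simp: avg_F sc_def)
  ultimately show ?thesis
    using lam by (simp add: sc_def power2_eq_square mult.assoc)
qed

lemma grad_avg: "x \<in> Rd d \<Longrightarrow> grad d (avg n F) x = (\<lambda>c. lam * L / 256 * gobj {..<d} (sc x) c)"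
  by (rule grad_eq[OF has_grad_avg])

lemma smooth_avg: "smooth_with d L (avg n F)"
  unfolding smooth_with_def
proof (intro ballI)
  fix x y assume x: "x \<in> Rd d" and y: "y \<in> Rd d"
  have "vnorm d (grad d (avg n F) x - grad d (avg n F) y)
      = vnorm d (\<lambda>c. lam * L / 256 * (gobj {..<d} (sc x) - gobj {..<d} (sc y)) c)"
    by (simp add: grad_avg x y fun_diff_def right_diff_distrib)
  also have "\<dots> = lam * L / 256 * vnorm d (gobj {..<d} (sc x) - gobj {..<d} (sc y))"
    unfolding vnorm_cmult using lam L by (simp add: fun_diff_def)
  also have "\<dots> \<le> lam * L / 256 * (256 * vnorm d (sc x - sc y))"
    using lam L by (intro mult_left_mono gobj_lipschitz) auto
  also have "sc x - sc y = (\<lambda>c. 1 / lam * (x - y) c)"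
    by (auto simp: sc_def diff_divide_distrib)
  also have "lam * L / 256 * (256 * vnorm d (\<lambda>c. 1 / lam * (x - y) c)) = L * vnorm d (x - y)"
    unfolding vnorm_cmult using lam by (simp add: fun_diff_def)
  finally show "vnorm d (grad d (avg n F) x - grad d (avg n F) y) \<le> L * vnorm d (x - y)" .
qed

lemma grad_avg_large:
  assumes x: "x \<in> Rd d" and gate: "gate K (sc x) = 0"
  shows "2 * \<epsilon> \<le> (vnorm d (grad d (avg n F) x))\<^sup>2"
proof -
  have "2 * \<epsilon> = (lam * L / 256)\<^sup>2 * (1 / 64)" using lam_L by simp
  also have "\<dots> \<le> (lam * L / 256)\<^sup>2 * (vnorm d (gobj {..<d} (sc x)))\<^sup>2"
    using gate by (intro mult_left_mono gobj_large) auto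
  also have "\<dots> = (vnorm d (grad d (avg n F) x))\<^sup>2"
    unfolding grad_avg[OF x] vnorm_cmult power_mult_distrib[of "\<bar>_\<bar>"] power2_abs ..
  finally show ?thesis .
qed

lemma avg_gap:
  assumes "lam\<^sup>2 * L / 256 * real K \<le> \<Delta>"
  shows "\<exists>fstar. (\<forall>x\<in>Rd d. fstar \<le> avg n F x) \<and> avg n F (\<lambda>_. 0) - fstar \<le> \<Delta>"
proof (intro exI conjI ballI)
  have pos: "0 \<le> lam\<^sup>2 * L / 256" using L by simp
  show "lam\<^sup>2 * L / 256 * (- real K) \<le> avg n F x" for x
    unfolding avg_F by (intro mult_left_mono obj_ge pos)
  have "avg n F (\<lambda>_. 0) \<le> 0"
    unfolding avg_F by (rule mult_nonneg_nonpos[OF pos]) (simp add: sc_def obj_0)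
  with assms show "avg n F (\<lambda>_. 0) - lam\<^sup>2 * L / 256 * (- real K) \<le> \<Delta>" by simp
qed

lemma noisy_G_le:
  assumes "noisy i x c"
  shows "(G i x c)\<^sup>2 \<le> 32 * (real n)\<^sup>2 * \<epsilon> * (al c)\<^sup>2"
proof -
  let ?u = "gate (st c - 1) (sc x)"
  have c: "c < d" "c \<in> own i" "sc x c = 0" using assms by (auto simp: noisy_def own_def sc_def)
  have "(G i x c)\<^sup>2 = (real n)\<^sup>2 * (lam * L / 256)\<^sup>2 * ((al c)\<^sup>2 * ?u\<^sup>2 / 4)"
    using c by (simp add: G_def gobj_at_zero power_mult_distrib power_divide)
  also have "\<dots> = 32 * (real n)\<^sup>2 * \<epsilon> * (al c)\<^sup>2 * ?u\<^sup>2"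
    unfolding lam_L by simp
  also have "\<dots> \<le> 32 * (real n)\<^sup>2 * \<epsilon> * (al c)\<^sup>2 * 1"
    using \<epsilon> gate_bounds by (intro mult_left_mono power_le_one) auto
  finally show ?thesis by simp
qed

lemma card_part_le: 
  assumes "m \<in> {1..K}" "i \<in> {1..n}"
  shows "card (part m i) \<le> B m i"
proof -
  have "inj_on idx (part m i)"
    using idx_inj by (auto simp: inj_on_def part_def blk_def own_def)
  moreover have "idx ` part m i \<subseteq> {..<B m i}"
    using idx_less by (auto simp: part_def blk_def own_def)
  ultimately show ?thesis
    using card_inj_on_le[of idx "part m i" "{..<B m i}"] by simp
qed

lemma noisy_mean:
  assumes c: "noisy i x c"
  shows "(\<Sum>b<bs i x. if real b = real (idx c) then real (B (st c) i) else 0) = real (bs i x)"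
    "(\<Sum>b<bs i x. ((if real b = real (idx c) then real (B (st c) i) else 0) - 1)\<^sup>2)
      = real (bs i x) * (real (bs i x) - 1)"
proof -
  have st: "c < d" "wk c = i" "st c \<in> {1..K}" and f: "front (st c) x"
    using c st_range by (auto simp: noisy_def own_def)
  have b: "bs i x = B (st c) i" by (rule bs_eq[OF st(3) f])
  have idx: "idx c < bs i x" using idx_less[OF st(1)] st(2) b by simp
  show "(\<Sum>b<bs i x. if real b = real (idx c) then real (B (st c) i) else 0) = real (bs i x)"
    using idx by (simp add: b)
  have "(\<Sum>b<bs i x. ((if real b = real (idx c) then real (B (st c) i) else 0) - 1)\<^sup>2)
      = (\<Sum>b<bs i x. 1 + (if b = idx c then (real (bs i x) - 1)\<^sup>2 - 1 else 0))"
    by (intro sum.cong) (auto simp: b)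
  also have "\<dots> = real (bs i x) + ((real (bs i x) - 1)\<^sup>2 - 1)"
    unfolding sum.distrib using idx by simp
  also have "\<dots> = real (bs i x) * (real (bs i x) - 1)"
    by (simp add: power2_eq_square algebra_simps)
  finally show "(\<Sum>b<bs i x. ((if real b = real (idx c) then real (B (st c) i) else 0) - 1)\<^sup>2)
      = real (bs i x) * (real (bs i x) - 1)" .
qed

lemma stochastic_gradients_g:
  "stochastic_gradients d n \<sigma> F noise_space (\<lambda>i x t. uniform_noise (bs i x)) g"
  unfolding stochastic_gradients_def
proof (intro ballI allI impI conjI)
  fix i x t assume i: "i \<in> {1..n}" and x: "x \<in> Rd d"
  have gF: "grad d (F i) x = G i x" by (rule grad_eq[OF has_grad_F x])
  have pos: "0 < bs i x" by (rule bs_pos)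
  show "prob_space (uniform_noise (bs i x))" "sets (uniform_noise (bs i x)) = sets noise_space"
    by (fact uniform_noise_props)+
  show "g i x \<xi> t \<in> Rd d" for \<xi> by (rule g_Rd)
  show "integrable (uniform_noise (bs i x)) (\<lambda>\<xi>. g i x \<xi> t j)" for j
    by (rule uniform_noise_integral(1)[OF pos])
  show "integrable (uniform_noise (bs i x)) (\<lambda>\<xi>. (vnorm d (g i x \<xi> t - grad d (F i) x))\<^sup>2)"
    by (rule uniform_noise_integral(1)[OF pos])
  show "(\<integral>\<xi>. g i x \<xi> t j \<partial>uniform_noise (bs i x)) = grad d (F i) x j" for j
  proof (cases "noisy i x j")
    case True
    then show ?thesis
      unfolding uniform_noise_integral(2)[OF pos] gF g_def sum_distrib_right[symmetric]
      using noisy_mean(1)[OF True] pos by simp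
  next
    case False
    then show ?thesis
      unfolding uniform_noise_integral(2)[OF pos] gF g_def using pos by simp
  qed
  let ?Z = "{c. c < d \<and> noisy i x c}"
  let ?e = "\<lambda>c \<xi>. ((if \<xi> = real (idx c) then real (B (st c) i) else 0) - 1)\<^sup>2"
  have sq: "(vnorm d (g i x \<xi> t - G i x))\<^sup>2 = (\<Sum>c\<in>?Z. ?e c \<xi> * (G i x c)\<^sup>2)" for \<xi>
  proof -
    have "(vnorm d (g i x \<xi> t - G i x))\<^sup>2 = (\<Sum>c<d. if noisy i x c then ?e c \<xi> * (G i x c)\<^sup>2 else 0)"
      unfolding vnorm_sq by (intro sum.cong) (auto simp: g_def power2_eq_square algebra_simps)
    also have "\<dots> = (\<Sum>c\<in>?Z. ?e c \<xi> * (G i x c)\<^sup>2)"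
      by (simp add: sum.inter_filter[symmetric])
    finally show ?thesis .
  qed
  have "(\<integral>\<xi>. (vnorm d (g i x \<xi> t - grad d (F i) x))\<^sup>2 \<partial>uniform_noise (bs i x))
      = (\<Sum>c\<in>?Z. \<Sum>b<bs i x. ?e c (real b) * (G i x c)\<^sup>2) / real (bs i x)"
    unfolding gF sq uniform_noise_integral(2)[OF pos] by (subst sum.swap) simp
  also have "\<dots> = (\<Sum>c\<in>?Z. real (bs i x) * (real (bs i x) - 1) * (G i x c)\<^sup>2) / real (bs i x)"
    using noisy_mean(2) by (simp flip: sum_distrib_right)
  also have "\<dots> = (real (bs i x) - 1) * (\<Sum>c\<in>?Z. (G i x c)\<^sup>2)"
    using pos by (simp add: mult.assoc flip: sum_distrib_left)
  also have "\<dots> \<le> \<sigma>\<^sup>2"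
  proof (cases "?Z = {}")
    case True
    show ?thesis unfolding True by simp
  next
    case False
    then obtain c0 where c0: "c0 < d" "noisy i x c0" by blast
    define m where "m = st c0"
    have m: "m \<in> {1..K}" "front m x" using c0 st_range by (auto simp: m_def noisy_def)
    have b: "bs i x = B m i" by (rule bs_eq[OF m])
    have Z: "?Z \<subseteq> part m i"
      using front_unique[OF m(1) _ m(2)] st_range by (auto simp: noisy_def part_def blk_def own_def)
    have "(\<Sum>c\<in>?Z. (G i x c)\<^sup>2) \<le> (\<Sum>c\<in>?Z. 32 * (real n)\<^sup>2 * \<epsilon> * (w m i / real (B m i)))"
    proof (rule sum_mono)
      fix c assume c: "c \<in> ?Z"
      with Z have "c \<in> part m i" by blast
      then have "(al c)\<^sup>2 = w m i / real (B m i)"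
        using al_sq by (auto simp: part_def blk_def own_def)
      with noisy_G_le c show "(G i x c)\<^sup>2 \<le> 32 * (real n)\<^sup>2 * \<epsilon> * (w m i / real (B m i))"
        by force
    qed
    also have "\<dots> = real (card ?Z) * (32 * (real n)\<^sup>2 * \<epsilon> * (w m i / real (B m i)))" by simp
    also have "\<dots> \<le> real (B m i) * (32 * (real n)\<^sup>2 * \<epsilon> * (w m i / real (B m i)))"
      using card_mono[OF finite_part Z] card_part_le[OF m(1) i] \<epsilon> w_nonneg
      by (intro mult_right_mono) auto
    also have "\<dots> = 32 * (real n)\<^sup>2 * \<epsilon> * w m i" using pos b by simp
    finally have "(real (B m i) - 1) * (\<Sum>c\<in>?Z. (G i x c)\<^sup>2)
        \<le> (real (B m i) - 1) * (32 * (real n)\<^sup>2 * \<epsilon> * w m i)"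
      using B_ge_1 by (intro mult_left_mono) auto
    also have "\<dots> \<le> \<sigma>\<^sup>2" using variance[OF m(1) i] by (simp add: mult.commute)
    finally show ?thesis unfolding b .
  qed
  finally show "(\<integral>\<xi>. (vnorm d (g i x \<xi> t - grad d (F i) x))\<^sup>2 \<partial>uniform_noise (bs i x)) \<le> \<sigma>\<^sup>2" .
qed

lemma hard_instance:
  assumes zr: "zero_respecting d n A" and T: "0 \<le> T"
    and T_less: "\<And>t. ereal t \<le> T \<Longrightarrow> ereal t < tau K"
    and \<Delta>: "lam\<^sup>2 * L / 256 * real K \<le> \<Delta>"
  shows "hard_for d n V L \<Delta> \<epsilon> \<sigma> A T"
  unfolding hard_for_def
proof (intro exI[of _ "count_space {F}"] exI[of _ noise_space]
    exI[of _ "\<lambda>_ i x t. uniform_noise (bs i x)"] exI[of _ "\<lambda>_. g"] conjI ballI)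
  show "prob_space (count_space {F})" by (rule prob_spaceI) simp
  have point: "protocol_point V g A \<omega> k \<in> Rd d" for \<omega> k
  proof -
    obtain gs s where p: "protocol V g A \<omega> k = (gs, s)" by fastforce
    then have "set gs \<subseteq> Rd d" using invar_protocol[OF zr, of \<omega> k] by (simp add: invar_def[OF zr])
    then show ?thesis
      using zr unfolding zero_respecting_def protocol_point_def p by (force split: prod.splits)
  qed
  have ge: "2 * \<epsilon> \<le> (vnorm d (grad d (avg n F) (protocol_point V g A \<omega> k)))\<^sup>2"
    if "ereal (protocol_time V g A \<omega> k) \<le> T" for \<omega> k
    by (intro grad_avg_large point last_gate_closed[OF zr] T_less that)
  note b = best_grad_norm_integral_ge[of T V g A "2 * \<epsilon>" d "avg n F" bs, OF T ge]
  {
    fix F' assume "F' \<in> space (count_space {F})"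
    then have F': "F' = F" by simp
    show "differentiable_Rd d (avg n F')"
      unfolding differentiable_Rd_def F' using has_grad_avg by blast
    show "smooth_with d L (avg n F')" unfolding F' by (rule smooth_avg)
    show "\<exists>fstar. (\<forall>x\<in>Rd d. fstar \<le> avg n F' x) \<and> avg n F' (\<lambda>_. 0) - fstar \<le> \<Delta>"
      unfolding F' by (rule avg_gap[OF \<Delta>])
    show "differentiable_Rd d (F' i)" for i
      unfolding differentiable_Rd_def F' using has_grad_F by blast
    show "stochastic_gradients d n \<sigma> F' noise_space (\<lambda>i x t. uniform_noise (bs i x)) g"
      unfolding F' by (rule stochastic_gradients_g)
    show "Ionescu_Tulcea (noise_kernel V (\<lambda>i x t. uniform_noise (bs i x)) g A) (\<lambda>_. noise_space)"
      by (rule Ionescu_Tulcea_noise)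
    show "integrable (noise_law V noise_space (\<lambda>i x t. uniform_noise (bs i x)) g A)
        (best_grad_norm d (avg n F') V g A T)"
      unfolding F' by (rule b(1))
  }
  show "\<epsilon> < (\<integral>F. (\<integral>\<omega>. best_grad_norm d (avg n F) V g A T \<omega>
      \<partial>noise_law V noise_space (\<lambda>i x t. uniform_noise (bs i x)) g A) \<partial>count_space {F})"
    using b(2) \<epsilon> by (simp add: lebesgue_integral_count_space_finite)
qed (auto intro: integrable_count_space)

end

lemma (in work) tau_pos: "1 \<le> k \<Longrightarrow> 0 < tau k"
  using tau_less[of 0 0] tau_mono[of 1 k] by (simp add: zero_ereal_def)

lemma (in work) less_tau_if_le_half:
  assumes k: "1 \<le> k" and t: "ereal t \<le> tau k / 2"
  shows "ereal t < tau k"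
proof (cases "tau k")
  case (real r)
  with tau_pos[OF k] t show ?thesis by simp
next
  case MInf
  with tau_pos[OF k] show ?thesis by simp
qed simp

lemma (in work) coordinates_exist:
  fixes w :: "nat \<Rightarrow> nat \<Rightarrow> real" and B :: "nat \<Rightarrow> nat \<Rightarrow> nat"
  assumes w: "\<And>m i. 0 \<le> w m i" "\<And>m. m \<in> {1..K} \<Longrightarrow> (\<Sum>i\<in>{1..n}. w m i) = 1"
    and B: "\<And>m i. 1 \<le> B m i"
  obtains d st wk idx where
    "chain d K st (\<lambda>c. sqrt (w (st c) (wk c) / real (B (st c) (wk c))))"
    "\<And>c. c < d \<Longrightarrow> wk c \<in> {1..n}" "\<And>c. c < d \<Longrightarrow> idx c < B (st c) (wk c)"
    "\<And>c c'. c < d \<Longrightarrow> c' < d \<Longrightarrow> st c = st c' \<Longrightarrow> wk c = wk c' \<Longrightarrow> idx c = idx c' \<Longrightarrow> c = c'"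
proof -
  define X where "X = {(m, i, b). m \<in> {1..K} \<and> i \<in> {1..n} \<and> 0 < w m i \<and> b < B m i}"
  have "X \<subseteq> (SIGMA m:{1..K}. SIGMA i:{1..n}. {..<B m i})" by (auto simp: X_def)
  then have "finite X" by (rule finite_subset) auto
  then obtain h where h: "bij_betw h {0..<card X} X"
    using ex_bij_betw_nat_finite by blast
  define d where "d = card X"
  define st where "st c = fst (h c)" for c
  define wk where "wk c = fst (snd (h c))" for c
  define idx where "idx c = snd (snd (h c))" for c
  have hX: "h c \<in> X" if "c < d" for c
    using h that by (auto simp: d_def bij_betw_def)
  have h_eq: "h c = (st c, wk c, idx c)" for c by (simp add: st_def wk_def idx_def)
  have props: "st c \<in> {1..K}" "wk c \<in> {1..n}" "0 < w (st c) (wk c)" "idx c < B (st c) (wk c)"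
    if "c < d" for c
    using hX[OF that] by (auto simp: h_eq X_def)
  have chain: "chain d K st (\<lambda>c. sqrt (w (st c) (wk c) / real (B (st c) (wk c))))"
  proof
    show "0 < sqrt (w (st c) (wk c) / real (B (st c) (wk c)))" if "c < d" for c
      using props(3)[OF that] B[of "st c" "wk c"] by simp
    show "st c \<in> {1..K}" if "c < d" for c by (rule props(1)[OF that])
    fix m assume m: "m \<in> {1..K}"
    let ?I = "SIGMA i:{i \<in> {1..n}. 0 < w m i}. {..<B m i}"
    have "bij_betw h {c. c < d \<and> st c = m} {x \<in> X. fst x = m}"
    proof -
      have "h ` {c. c < d \<and> st c = m} = {x \<in> h ` {0..<d}. fst x = m}"
        by (auto simp: st_def)
      moreover have "inj_on h {c. c < d \<and> st c = m}"
        using h by (auto simp: bij_betw_def d_def inj_on_def)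
      ultimately show ?thesis using h by (simp add: bij_betw_def d_def)
    qed
    moreover have "{x \<in> X. fst x = m} = Pair m ` ?I"
      using m by (auto simp: X_def)
    ultimately have bij: "bij_betw h {c. c < d \<and> st c = m} (Pair m ` ?I)" by simp
    have "(\<Sum>c | c < d \<and> st c = m. (sqrt (w (st c) (wk c) / real (B (st c) (wk c))))\<^sup>2)
        = (\<Sum>c | c < d \<and> st c = m. (\<lambda>(m, i, b). w m i / real (B m i)) (h c))"
      using w(1) by (intro sum.cong) (auto simp: h_eq)
    also have "\<dots> = (\<Sum>(m, i, b)\<in>Pair m ` ?I. w m i / real (B m i))"
      by (rule sum.reindex_bij_betw[OF bij])
    also have "\<dots> = (\<Sum>(i, b)\<in>?I. w m i / real (B m i))"
      by (subst sum.reindex) (auto simp: inj_on_def case_prod_unfold)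
    also have "\<dots> = (\<Sum>i | i \<in> {1..n} \<and> 0 < w m i. \<Sum>b<B m i. w m i / real (B m i))"
      by (subst sum.Sigma) auto
    also have "\<dots> = (\<Sum>i | i \<in> {1..n} \<and> 0 < w m i. w m i)"
      using B by (intro sum.cong) (auto simp: Suc_le_eq)
    also have "\<dots> = (\<Sum>i\<in>{1..n}. w m i)"
      using w(1)[of m] by (intro sum.mono_neutral_left) (auto simp: not_less intro: antisym)
    also have "\<dots> = 1" by (rule w(2)[OF m])
    finally show "(\<Sum>c | c < d \<and> st c = m. (sqrt (w (st c) (wk c) / real (B (st c) (wk c))))\<^sup>2) = 1" .
  qed
  have inj: "c = c'" if "c < d" "c' < d" "st c = st c'" "wk c = wk c'" "idx c = idx c'" for c c'
    using h that by (auto simp: bij_betw_def d_def inj_on_def h_eq)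
  show ?thesis by (rule that[OF chain props(2,4) inj])
qed

lemma (in chain) d_pos: "1 \<le> K \<Longrightarrow> 1 \<le> d"
  using stage_weight[of 1] by (cases d) auto

lemma lower_bound:
  assumes n: "1 \<le> n" and v: "\<forall>i\<in>{1..n}. computation_power (v i)" and L: "0 < L"
    and \<epsilon>: "0 < \<epsilon>" and small: "\<epsilon> < 1 / 32768 * L * \<Delta>"
  shows "\<exists>d\<ge>1. \<forall>A. zero_respecting d n A \<longrightarrow> hard_for d n (computation_work v) L \<Delta> \<epsilon> \<sigma> A
    (t_lower n (computation_work v) 1 128 \<sigma> \<epsilon> (nat \<lfloor>1 / 32768 * L * \<Delta> / \<epsilon>\<rfloor>) / 2)"
proof -
  define K where "K = nat \<lfloor>1 / 32768 * L * \<Delta> / \<epsilon>\<rfloor>"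
  interpret work n "computation_work v" 1 128 \<sigma> \<epsilon>
    using n v computation_work_mono[of v] computation_work_right_continuous[of v]
    by unfold_locales auto
  have "1 \<le> 1 / 32768 * L * \<Delta> / \<epsilon>" using small \<epsilon> by (simp add: field_simps)
  then have K: "1 \<le> K" and K_le: "real K \<le> 1 / 32768 * L * \<Delta> / \<epsilon>"
    unfolding K_def by (simp_all add: le_nat_iff le_floor_iff of_nat_floor)
  define lam where "lam = 256 * sqrt (128 * \<epsilon>) / L"
  have lam: "0 < lam" "(lam * L / 256)\<^sup>2 = 128 * \<epsilon>"
    using L \<epsilon> by (simp_all add: lam_def)
  have "lam\<^sup>2 * L / 256 = (lam * L / 256)\<^sup>2 * 256 / L"
    using L by (simp add: power2_eq_square)
  also have "\<dots> = 32768 * \<epsilon> / L" using lam by simp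
  finally have "lam\<^sup>2 * L / 256 = 32768 * \<epsilon> / L" .
  then have "lam\<^sup>2 * L / 256 * real K = 32768 * \<epsilon> / L * real K" by (simp only:)
  also have "\<dots> \<le> 32768 * \<epsilon> / L * (1 / 32768 * L * \<Delta> / \<epsilon>)"
    using K_le L \<epsilon> by (intro mult_left_mono) auto
  also have "\<dots> = \<Delta>" using L \<epsilon> by simp
  finally have \<Delta>: "lam\<^sup>2 * L / 256 * real K \<le> \<Delta>" .
  define good where "good m w B \<longleftrightarrow> (\<forall>i. 0 \<le> w i) \<and> (\<Sum>i\<in>{1..n}. w i) = 1 \<and> (\<forall>i. 1 \<le> B i) \<and>
    (\<forall>i\<in>{1..n}. 32 * (real n)\<^sup>2 * \<epsilon> * w i * (real (B i) - 1) \<le> \<sigma>\<^sup>2) \<and>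
    (\<forall>t. 0 \<le> t \<longrightarrow> ereal t < tau m \<longrightarrow> (\<Sum>i\<in>{1..n}. w i * real (jobs m i t) / real (B i)) \<le> 1 / 4)"
    for m and w :: "nat \<Rightarrow> real" and B :: "nat \<Rightarrow> nat"
  have "\<exists>w B. good (max 1 m) w B" for m
    unfolding good_def by (rule weights_exist[OF refl refl \<epsilon>]) simp
  then obtain w B where good: "\<And>m. good (max 1 m) (w m) (B m)" by metis
  have wB: "0 \<le> w m i" "1 \<le> B m i" for m i using good[of m] by (auto simp: good_def)
  have good': "good m (w m) (B m)" if "m \<in> {1..K}" for m
    using good[of m] that by (simp add: max_def split: if_splits)
  then have w1: "(\<Sum>i\<in>{1..n}. w m i) = 1" if "m \<in> {1..K}" for m
    using that unfolding good_def by blast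
  show ?thesis
  proof (rule coordinates_exist[of w K B, OF wB(1) w1 wB(2)])
    fix d st wk idx assume c: "chain d K st (\<lambda>c. sqrt (w (st c) (wk c) / real (B (st c) (wk c))))"
      "\<And>c. c < d \<Longrightarrow> wk c \<in> {1..n}" "\<And>c. c < d \<Longrightarrow> idx c < B (st c) (wk c)"
      "\<And>c c'. c < d \<Longrightarrow> c' < d \<Longrightarrow> st c = st c' \<Longrightarrow> wk c = wk c' \<Longrightarrow> idx c = idx c' \<Longrightarrow> c = c'"
    interpret chain d K st "\<lambda>c. sqrt (w (st c) (wk c) / real (B (st c) (wk c)))" by (rule c(1))
    interpret hard d K st "\<lambda>c. sqrt (w (st c) (wk c) / real (B (st c) (wk c)))" n "computation_work v" \<sigma> \<epsilon> wk idx w B lam L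
    proof
      show "32 * (real n)\<^sup>2 * \<epsilon> * w m i * (real (B m i) - 1) \<le> \<sigma>\<^sup>2"
        if "m \<in> {1..K}" "i \<in> {1..n}" for m i
        using good'[OF that(1)] that(2) unfolding good_def by blast
      show "(\<Sum>i\<in>{1..n}. w m i * real (jobs m i t) / real (B m i)) \<le> 1 / 4"
        if "m \<in> {1..K}" "0 \<le> t" "ereal t < tau m" for m t
        using good'[OF that(1)] that(2,3) unfolding good_def by blast
      show "(sqrt (w (st c) (wk c) / real (B (st c) (wk c))))\<^sup>2 = w (st c) (wk c) / real (B (st c) (wk c))"
        for c using wB(1) by simp
    qed (fact K L \<epsilon> lam wB c)+
    have T: "0 \<le> tau K / 2" using tau_nonneg[of K] by (cases "tau K") auto
    show ?thesis
      unfolding K_def[symmetric]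
      using d_pos[OF K] hard_instance[OF _ T less_tau_if_le_half[OF K] \<Delta>] by blast
  qed
qed

theorem theorem6p2:
  shows "\<exists>c' c1 c2 c3 :: real. 0 < c' \<and> 0 < c1 \<and> 0 < c2 \<and> 0 < c3 \<and>
    (\<forall>(n::nat) (v :: nat \<Rightarrow> real \<Rightarrow> real) (L::real) (\<Delta>::real) (\<epsilon>::real) (\<sigma>::real).
      1 \<le> n \<longrightarrow> (\<forall>i\<in>{1..n}. computation_power (v i)) \<longrightarrow>
      0 < L \<longrightarrow> 0 < \<Delta> \<longrightarrow> 0 < \<epsilon> \<longrightarrow> 0 \<le> \<sigma> \<longrightarrow> \<epsilon> < c' * L * \<Delta> \<longrightarrow>
      (let V = computation_work v;
           T = t_lower n V c2 c3 \<sigma> \<epsilon> (nat \<lfloor>c1 * L * \<Delta> / \<epsilon>\<rfloor>) / 2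
       in \<exists>d\<ge>1. \<forall>A. zero_respecting d n A \<longrightarrow>
        (\<exists>(M :: (nat \<Rightarrow> vect \<Rightarrow> real) measure)
          (N :: real measure)
          (D :: (nat \<Rightarrow> vect \<Rightarrow> real) \<Rightarrow> nat \<Rightarrow> vect \<Rightarrow> real \<Rightarrow> real measure)
          (g :: (nat \<Rightarrow> vect \<Rightarrow> real) \<Rightarrow> nat \<Rightarrow> vect \<Rightarrow> real \<Rightarrow> real \<Rightarrow> vect).
          prob_space M \<and>
          (\<forall>i\<in>{1..n}. \<forall>x\<in>Rd d. (\<lambda>F. F i x) \<in> borel_measurable M) \<and>
          (\<forall>F\<in>space M.
             differentiable_Rd d (avg n F) \<and> smooth_with d L (avg n F) \<and>
             (\<exists>fstar::real. (\<forall>x\<in>Rd d. fstar \<le> avg n F x) \<and> avg n F (\<lambda>_. 0) - fstar \<le> \<Delta>) \<and>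
             (\<forall>i\<in>{1..n}. differentiable_Rd d (F i)) \<and>
             stochastic_gradients d n \<sigma> F N (D F) (g F) \<and>
             Ionescu_Tulcea (noise_kernel V (D F) (g F) A) (\<lambda>_. N) \<and>
             integrable (noise_law V N (D F) (g F) A)
               (best_grad_norm d (avg n F) V (g F) A T)) \<and>
          integrable M (\<lambda>F. \<integral>\<omega>. best_grad_norm d (avg n F) V (g F) A T \<omega>
                               \<partial>noise_law V N (D F) (g F) A) \<and>
          (\<integral>F. (\<integral>\<omega>. best_grad_norm d (avg n F) V (g F) A T \<omega>
                    \<partial>noise_law V N (D F) (g F) A) \<partial>M) > \<epsilon>)))"
  unfolding Let_def hard_for_def[symmetric]
  by (rule exI[of _ "1 / 32768"], rule exI[of _ "1 / 32768"], rule exI[of _ 1], rule exI[of _ 128],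
      intro conjI allI impI lower_bound) simp_all

end
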